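(* Let $(X,\mathcal{A},\mu,T)$ be an ergodic probability preserving system, $Y\in\mathcal{A}$ (with $\mu(Y)>0$), $(A_l)$ an asymptotically rare sequence in $\mathcal{A}\cap Y$, and $(\psi_{A_l})_{l\ge1}$ a sequence of $\mathfrak{F}$-valued local observables for the $A_l$ with corresponding local processes $\Psi_{A_l}$. Let $(\Phi,\Psi)$ be a random element of $[0,\infty)^{\mathbb{N}}\times\mathfrak{F}^{\mathbb{N}}$. Then, as $l\to\infty$, $$(\mu(A_l)\Phi_{A_l},\Psi_{A_l})\overset{\mu}{\Longrightarrow}(\Phi,\Psi)\quad\text{iff}\quad(\mu_Y(A_l)\Phi^Y_{A_l},\Psi_{A_l})\overset{\mu_Y}{\Longrightarrow}(\Phi,\Psi).$$
   Context: $(\mathfrak{F},d_{\mathfrak{F}})$ compact metric space. For $A$ with $\mu(A)>0$: $\varphi_A(x):=\inf\{n\ge1:T^nx\in A\}$, $T_Ax:=T^{\varphi_A(x)}x$, $\mu_A:=\mu(A\cap\cdot)/\mu(A)$, $\Phi_A:=(\varphi_A,\varphi_A\circ T_A,\ldots)$. $T_Y:Y\to Y$ is the first-return map of $Y$; for $A\subseteq Y$, $\varphi^Y_A(x):=\inf\{j\ge1:T_Y^jx\in A\}$ ($x\in Y$) and $\Phi^Y_A:=(\varphi^Y_A,\varphi^Y_A\circ T_A,\varphi^Y_A\circ T_A^2,\ldots)$ on $Y$. Local observable: measurable $\psi_A:A\to\mathfrak{F}$; $\Psi_A:=(\psi_A\circ T_A,\psi_A\circ T_A^2,\ldots)$.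 Asymptotically rare: $0<\mu(A_l)\to0$. $[0,\infty]$ is metrized by $|e^{-s}-e^{-t}|$ and sequence spaces carry product metrics; $\overset{\nu}{\Longrightarrow}$: weak convergence of laws under $\nu$. *)

theory Defs
  imports "HOL-Probability.Probability"
begin

definition mpt :: "'a measure \<Rightarrow> ('a \<Rightarrow> 'a) \<Rightarrow> bool" where
  "mpt M T \<longleftrightarrow> T \<in> measurable M M \<and> (\<forall>B \<in> sets M. emeasure M (T -` B \<inter> space M) = emeasure M B)"

definition ergodic_pps :: "'a measure \<Rightarrow> ('a \<Rightarrow> 'a) \<Rightarrow> bool" where
  "ergodic_pps M T \<longleftrightarrow> prob_space M \<and> mpt M T \<and>
     (\<forall>B \<in> sets M. T -` B \<inter> space M = B \<longrightarrow> measure M B = 0 \<or> measure M B = 1)"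

definition hit :: "('a \<Rightarrow> 'a) \<Rightarrow> 'a set \<Rightarrow> 'a \<Rightarrow> enat" where
  "hit T A x = (if \<exists>n\<ge>1. (T ^^ n) x \<in> A then enat (LEAST n. n \<ge> 1 \<and> (T ^^ n) x \<in> A) else \<infinity>)"

(* T_A x = T^{phi_A(x)} x  (convention: T_A x = x where phi_A(x) = \<infinity>, a null set) *)
definition retmap :: "('a \<Rightarrow> 'a) \<Rightarrow> 'a set \<Rightarrow> 'a \<Rightarrow> 'a" where
  "retmap T A x = (case hit T A x of enat n \<Rightarrow> (T ^^ n) x | \<infinity> \<Rightarrow> x)"

definition scaled_Phi :: "'a measure \<Rightarrow> ('a \<Rightarrow> 'a) \<Rightarrow> 'a set \<Rightarrow> 'a \<Rightarrow> nat \<Rightarrow> ennreal" where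
  "scaled_Phi M T A x = (\<lambda>k. ennreal (measure M A) * ennreal_of_enat (hit T A ((retmap T A ^^ k) x)))"

definition scaled_Phi_Y :: "'a measure \<Rightarrow> ('a \<Rightarrow> 'a) \<Rightarrow> 'a set \<Rightarrow> 'a set \<Rightarrow> 'a \<Rightarrow> nat \<Rightarrow> ennreal" where
  "scaled_Phi_Y M T Y A x = (\<lambda>k. ennreal (measure (uniform_measure M Y) A) *
       ennreal_of_enat (hit (retmap T Y) A ((retmap T A ^^ k) x)))"

definition local_proc :: "('a \<Rightarrow> 'a) \<Rightarrow> 'a set \<Rightarrow> ('a \<Rightarrow> 'f) \<Rightarrow> 'a \<Rightarrow> nat \<Rightarrow> 'f" where
  "local_proc T A psi x = (\<lambda>k. psi ((retmap T A ^^ Suc k) x))"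

definition weak_conv :: "(nat \<Rightarrow> 'b::topological_space measure) \<Rightarrow> 'b measure \<Rightarrow> bool" where
  "weak_conv Ps P \<longleftrightarrow> (\<forall>f :: 'b \<Rightarrow> real. continuous_on UNIV f \<and> bounded (range f) \<longrightarrow>
      (\<lambda>n. integral\<^sup>L (Ps n) f) \<longlonglongrightarrow> integral\<^sup>L P f)"

definition conv_in_law :: "'a measure \<Rightarrow> (nat \<Rightarrow> 'a \<Rightarrow> 'b::topological_space) \<Rightarrow> 'w measure \<Rightarrow> ('w \<Rightarrow> 'b) \<Rightarrow> bool" where
  "conv_in_law nu X P Z \<longleftrightarrow> weak_conv (\<lambda>l. distr nu borel (X l)) (distr P borel Z)"

end

theory Submission
  imports Defs
begin

text \<open>
  By Garsia's argument the number \<open>visits T Y n x\<close> of visits to \<open>Y\<close> up to time \<open>n\<close> satisfies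
  \<open>visits T Y n x / n \<longlongrightarrow> \<mu>(Y)\<close> for almost every \<open>x\<close> and in mean. Two comparisons then give the theorem.

  First, applying \<open>T\<close> changes \<open>(\<mu>(A\<^sub>l) \<Phi>, \<Psi>)\<close> only in the first entry of \<open>\<Phi>\<close>, by \<open>\<mu>(A\<^sub>l)\<close>, outside the set
  \<open>T\<^sup>-\<^sup>1 A\<^sub>l\<close> of small measure. Such asymptotically invariant maps have the same limit law
  under \<open>\<mu>\<close> and under \<open>\<mu>\<^sub>Y\<close>, by the mean ergodic theorem for the indicator of \<open>Y\<close>.

  Second, as \<open>A\<^sub>l \<subseteq> Y\<close>, if the \<open>k\<close>-th visit to \<open>A\<^sub>l\<close> happens at time \<open>n\<close> of \<open>T\<close>, then it happens at
  time \<open>visits T Y n x\<close> of the return map of \<open>Y\<close>. Hitting times of \<open>A\<^sub>l\<close> are large with high probability, so the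
  normalised \<open>k\<close>-th visit times of the two systems have ratio close to 1. Since the limit process is
  finite, these times are tight, so the normalised waiting times are close, too.
\<close>

section \<open>Birkhoff averages of bounded functions\<close>

text \<open>Invariance is stated as an equality of measures, so that facts about
  \<open>distr\<close> transport integrals and probabilities along orbits.\<close>

locale ergodic_system = prob_space M for M :: "'a measure" +
  fixes T :: "'a \<Rightarrow> 'a"
  assumes T_measurable [measurable]: "T \<in> measurable M M"
    and distr_T: "distr M M T = M"
    and ergodic: "\<And>B. B \<in> sets M \<Longrightarrow> T -` B \<inter> space M = B \<Longrightarrow> prob B = 0 \<or> prob B = 1"
begin

lemma funpow_measurable [measurable]: "T ^^ n \<in> measurable M M"
  by (rule measurable_compose_n) measurable

lemma T_space: "x \<in> space M \<Longrightarrow> T x \<in> space M"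
  using T_measurable by (rule measurable_space)

lemma integral_T:
  fixes f :: "'a \<Rightarrow> real"
  assumes [measurable]: "f \<in> borel_measurable M"
  shows "(\<integral>x. f (T x) \<partial>M) = (\<integral>x. f x \<partial>M)"
  by (subst distr_T[symmetric], rule integral_distr[symmetric]) measurable

lemma distr_funpow: "distr M M (T ^^ n) = M"
proof (induction n)
  case 0
  then show ?case by (simp add: id_def distr_id)
next
  case (Suc n)
  have "distr M M (T ^^ Suc n) = distr (distr M M (T ^^ n)) M T"
    by (subst distr_distr) auto
  then show ?case by (simp only: Suc distr_T)
qed

lemma prob_funpow_vimage:
  assumes [measurable]: "B \<in> sets M"
  shows "prob ((T ^^ n) -` B \<inter> space M) = prob B"
proof -
  have "measure (distr M M (T ^^ n)) B = prob ((T ^^ n) -` B \<inter> space M)"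
    by (rule measure_distr) measurable
  then show ?thesis by (simp add: distr_funpow)
qed

text \<open>This is the maximum of the orbit sums of \<open>f\<close> of length at most
  \<open>n\<close>, the empty sum 0 included. The recursion relates \<open>max_sum f (Suc n)\<close>
  at \<open>x\<close> to \<open>max_sum f n\<close> at \<open>T x\<close>, as Garsia's argument
  requires.\<close>

fun max_sum :: "('a \<Rightarrow> real) \<Rightarrow> nat \<Rightarrow> 'a \<Rightarrow> real" where
  "max_sum f 0 x = 0"
| "max_sum f (Suc n) x = max 0 (f x + max_sum f n (T x))"

lemma max_sum_nonneg: "0 \<le> max_sum f n x"
  by (cases n) auto

lemma max_sum_Suc_mono: "max_sum f n x \<le> max_sum f (Suc n) x"
proof (induction n arbitrary: x)
  case (Suc n)
  show ?case using Suc.IH[of "T x"] unfolding max_sum.simps(2)[of f _ x] by linarith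
qed simp

lemma max_sum_measurable [measurable]:
  assumes [measurable]: "f \<in> borel_measurable M"
  shows "max_sum f n \<in> borel_measurable M"
proof (induction n)
  case (Suc n)
  note [measurable] = Suc
  show ?case by (subst max_sum.simps(2)[abs_def]) measurable
qed simp

lemma max_sum_le:
  assumes "\<And>x. \<bar>f x\<bar> \<le> C"
  shows "max_sum f n x \<le> real n * C"
proof (induction n arbitrary: x)
  case (Suc n)
  have "0 \<le> C" using assms[of x] by linarith
  then show ?case using Suc[of "T x"] assms[of x] by (auto simp: algebra_simps max_def intro: mult_nonneg_nonneg)
qed simp

lemma sum_orbit_Suc:
  fixes f :: "'a \<Rightarrow> real"
  shows "(\<Sum>j<Suc n. f ((T ^^ j) x)) = f x + (\<Sum>j<n. f ((T ^^ j) (T x)))"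
  by (simp add: sum.lessThan_Suc_shift funpow_swap1 del: sum.lessThan_Suc)

lemma sum_orbit_le_max_sum: "(\<Sum>j<n. f ((T ^^ j) x)) \<le> max_sum f n x"
proof (induction n arbitrary: x)
  case (Suc n)
  show ?case using Suc.IH[of "T x"] unfolding sum_orbit_Suc max_sum.simps(2) by linarith
qed simp

text \<open>Garsia's argument: if the orbit sums were unbounded on a set of full measure, then
  \<open>max_sum f (n + 1) - max_sum f n \<circ> T\<close>, whose integral is nonnegative, would converge boundedly to \<open>f\<close>.\<close>

lemma AE_orbit_sums_bounded:
  fixes f :: "'a \<Rightarrow> real"
  assumes f [measurable]: "f \<in> borel_measurable M" and C: "\<And>x. \<bar>f x\<bar> \<le> C"
    and neg: "(\<integral>x. f x \<partial>M) < 0"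
  shows "AE x in M. \<exists>L. \<forall>n. (\<Sum>j<n. f ((T ^^ j) x)) \<le> L"
proof -
  define S :: "nat \<Rightarrow> 'a \<Rightarrow> real" where "S n x = (\<Sum>j<n. f ((T ^^ j) x))" for n x
  have S_meas [measurable]: "S n \<in> borel_measurable M" for n
    unfolding S_def[abs_def] by measurable
  \<comment> \<open>Natural thresholds keep the description countable, hence measurable;
    \<open>E_iff\<close> restores real ones.\<close>
  define E where "E = {x \<in> space M. \<forall>L::nat. \<exists>n. S n x > real L}"
  have E_iff: "x \<in> E \<longleftrightarrow> x \<in> space M \<and> (\<forall>L::real. \<exists>n. S n x > L)" for x
    unfolding E_def by (auto, metis less_le_trans reals_Archimedean2 less_imp_le le_less_trans)
  have E_sets [measurable]: "E \<in> sets M" unfolding E_def by measurable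
  have S_Suc: "S (Suc n) x = f x + S n (T x)" for n x
    unfolding S_def by (rule sum_orbit_Suc)
  \<comment> \<open>Passing from \<open>x\<close> to \<open>T x\<close> shifts the length by one and
    changes the sums by the fixed number \<open>f x\<close>, so unboundedness is preserved both
    ways.\<close>
  have inv: "T -` E \<inter> space M = E"
  proof (intro set_eqI iffI)
    fix x assume x: "x \<in> T -` E \<inter> space M"
    have "\<exists>n. S n x > L" for L
    proof -
      obtain n where "S n (T x) > L - f x" using x by (auto simp: E_iff)
      then have "S (Suc n) x > L" by (simp add: S_Suc)
      then show ?thesis ..
    qed
    then show "x \<in> E" using x by (auto simp: E_iff)
  next
    fix x assume x: "x \<in> E"
    have "\<exists>n. S n (T x) > L" for L
    proof -
      \<comment> \<open>The 0 in the threshold rules out the empty sum, so that \<open>n\<close> has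
        a predecessor.\<close>
      obtain n where n: "S n x > max 0 (L + f x)" using x unfolding E_iff by blast
      then obtain m where "n = Suc m" by (cases n) (auto simp: S_def)
      then have "S m (T x) > L" using n by (simp add: S_Suc)
      then show ?thesis ..
    qed
    then show "x \<in> T -` E \<inter> space M" using x T_space by (auto simp: E_iff)
  qed
  have "prob E \<noteq> 1"
  proof
    assume "prob E = 1"
    then have AE_E: "AE x in M. x \<in> E" using prob_eq_1[OF E_sets] by simp
    have int: "integrable M (max_sum f n)" for n
      by (rule integrable_const_bound[where B="real n * C"])
        (auto simp: max_sum_nonneg max_sum_le[OF C])
    have intT: "integrable M (\<lambda>x. max_sum f n (T x))" for n
      by (rule integrable_const_bound[where B="real n * C"])
        (auto simp: max_sum_nonneg max_sum_le[OF C])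
    have "(\<lambda>n. \<integral>x. (max_sum f (Suc n) x - max_sum f n (T x)) \<partial>M) \<longlonglongrightarrow> (\<integral>x. f x \<partial>M)"
    proof (rule integral_dominated_convergence[where w="\<lambda>_. C"])
      show "AE x in M. (\<lambda>n. max_sum f (Suc n) x - max_sum f n (T x)) \<longlonglongrightarrow> f x"
        using AE_E
      proof eventually_elim
        case (elim x)
        then have "T x \<in> E" using inv by auto
        \<comment> \<open>Once the maximum at \<open>T x\<close> exceeds \<open>- f x\<close>, the
          truncation at 0 is inactive and the difference equals \<open>f x\<close> exactly.\<close>
        then obtain n0 where "S n0 (T x) > - f x" by (auto simp: E_iff)
        then have n0: "max_sum f n0 (T x) > - f x"
          using sum_orbit_le_max_sum[of f "T x" n0] unfolding S_def by linarith
        have "max_sum f n (T x) \<ge> max_sum f n0 (T x)" if "n \<ge> n0" for n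
          using lift_Suc_mono_le[of "\<lambda>n. max_sum f n (T x)", OF max_sum_Suc_mono that] .
        then have "\<forall>\<^sub>F n in sequentially. max_sum f (Suc n) x - max_sum f n (T x) = f x"
          using n0 by (intro eventually_sequentiallyI[of n0]) (force simp: max_def)
        then show ?case by (rule tendsto_eventually)
      qed
      \<comment> \<open>The difference is the larger of \<open>f x\<close> and
        \<open>- max_sum f n (T x)\<close>. The latter is at most 0, so if it is the larger one, its
        absolute value is at most that of \<open>f x\<close>.\<close>
      show "AE x in M. norm (max_sum f (Suc n) x - max_sum f n (T x)) \<le> C" for n
      proof (rule AE_I2)
        fix x show "norm (max_sum f (Suc n) x - max_sum f n (T x)) \<le> C"
          using C[of x] max_sum_nonneg[of f n "T x"] by (auto simp: max_def)
      qed
    qed auto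
    moreover have "0 \<le> (\<integral>x. (max_sum f (Suc n) x - max_sum f n (T x)) \<partial>M)" for n
    proof -
      \<comment> \<open>Invariance removes \<open>T\<close> from the second integral; monotonicity
        in \<open>n\<close> then gives the sign.\<close>
      have "(\<integral>x. (max_sum f (Suc n) x - max_sum f n (T x)) \<partial>M)
          = (\<integral>x. max_sum f (Suc n) x \<partial>M) - (\<integral>x. max_sum f n x \<partial>M)"
        using int[of "Suc n"] intT[of n]
        by (subst Bochner_Integration.integral_diff) (auto simp: integral_T simp del: max_sum.simps)
      moreover have "(\<integral>x. max_sum f n x \<partial>M) \<le> (\<integral>x. max_sum f (Suc n) x \<partial>M)"
        by (rule integral_mono[OF int int]) (rule max_sum_Suc_mono)
      ultimately show ?thesis by simp
    qed
    ultimately have "0 \<le> (\<integral>x. f x \<partial>M)" by (intro LIMSEQ_le_const) auto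
    then show False using neg by simp
  qed
  then have "prob E = 0" using ergodic[OF E_sets inv] by simp
  then have "AE x in M. x \<notin> E" using prob_eq_0[OF E_sets] by simp
  then show ?thesis
    by (rule AE_mp) (auto intro!: AE_I2 simp: E_iff S_def not_less)
qed

text \<open>Choose \<open>d\<close> strictly between the mean and \<open>c\<close>. Almost surely
  the sums of \<open>f - d\<close> have an upper bound \<open>L\<close>, so their averages are at
  most \<open>L / n\<close>, which is eventually below \<open>c - d\<close>.\<close>

lemma AE_orbit_average_eventually_less:
  fixes f :: "'a \<Rightarrow> real"
  assumes f [measurable]: "f \<in> borel_measurable M" and C: "\<And>x. \<bar>f x\<bar> \<le> C"
    and c: "(\<integral>x. f x \<partial>M) < c"
  shows "AE x in M. \<forall>\<^sub>F n in sequentially. (\<Sum>j<n. f ((T ^^ j) x)) / real n < c"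
proof -
  define d where "d = ((\<integral>x. f x \<partial>M) + c) / 2"
  have d: "(\<integral>x. f x \<partial>M) < d" "d < c" using c by (auto simp: d_def)
  have int: "integrable M f" by (rule integrable_const_bound[where B=C]) (auto simp: C)
  have "AE x in M. \<exists>L. \<forall>n. (\<Sum>j<n. f ((T ^^ j) x) - d) \<le> L"
  proof (rule AE_orbit_sums_bounded[where C="C + \<bar>d\<bar>"])
    show "\<bar>f x - d\<bar> \<le> C + \<bar>d\<bar>" for x using C[of x] by linarith
    show "(\<integral>x. f x - d \<partial>M) < 0" using d int by (simp add: prob_space)
  qed auto
  then show ?thesis
  proof eventually_elim
    case (elim x)
    then obtain L where L: "\<And>n. (\<Sum>j<n. f ((T ^^ j) x) - d) \<le> L" by blast
    have "(\<lambda>n. L / real n) \<longlonglongrightarrow> 0" by (rule lim_const_over_n)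
    then have "\<forall>\<^sub>F n in sequentially. L / real n < c - d"
      using d by (intro order_tendstoD) auto
    then show ?case using eventually_gt_at_top[of 0]
    proof eventually_elim
      case (elim n)
      have "(\<Sum>j<n. f ((T ^^ j) x)) \<le> L + real n * d"
        using L[of n] by (simp add: sum_subtractf)
      then have "(\<Sum>j<n. f ((T ^^ j) x)) / real n \<le> L / real n + d"
        using elim by (simp add: field_simps)
      then show ?case using elim by linarith
    qed
  qed
qed

text \<open>The one-sided bound is applied to \<open>f\<close> and to \<open>- f\<close>. Tolerances
  \<open>1 / (i + 1)\<close> suffice, so only countably many null sets have to be discarded.\<close>

theorem birkhoff_bounded:
  fixes f :: "'a \<Rightarrow> real"
  assumes f [measurable]: "f \<in> borel_measurable M" and C: "\<And>x. \<bar>f x\<bar> \<le> C"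
  shows "AE x in M. (\<lambda>n. (\<Sum>j<n. f ((T ^^ j) x)) / real n) \<longlonglongrightarrow> (\<integral>x. f x \<partial>M)"
proof -
  let ?m = "\<integral>x. f x \<partial>M"
  have up: "AE x in M. \<forall>i::nat. \<forall>\<^sub>F n in sequentially. (\<Sum>j<n. f ((T ^^ j) x)) / real n < ?m + 1 / real (Suc i)"
    unfolding AE_all_countable
    by (intro allI AE_orbit_average_eventually_less[OF f C]) simp
  have lo: "AE x in M. \<forall>i::nat. \<forall>\<^sub>F n in sequentially. (\<Sum>j<n. - f ((T ^^ j) x)) / real n < - ?m + 1 / real (Suc i)"
    unfolding AE_all_countable
    by (intro allI AE_orbit_average_eventually_less[where f="\<lambda>x. - f x" and C=C]) (auto simp: C)
  show ?thesis using up lo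
  proof eventually_elim
    case (elim x)
    show ?case
    proof (rule tendstoI)
      fix e :: real assume "0 < e"
      then obtain i where i: "1 / real (Suc i) < e" using nat_approx_posE by blast
      show "\<forall>\<^sub>F n in sequentially. dist ((\<Sum>j<n. f ((T ^^ j) x)) / real n) ?m < e"
        using elim(1)[rule_format, of i] elim(2)[rule_format, of i]
        by eventually_elim (use i in \<open>auto simp: dist_real_def sum_negf\<close>)
    qed
  qed
qed

end

section \<open>Sequences in the extended half-line\<close>

text \<open>The homeomorphism \<open>s \<mapsto> 1 / (1 + s)\<close> onto \<open>[0, 1]\<close> stands in for a metric on \<open>ennreal\<close>, a type without one.\<close>

definition squash :: "ennreal \<Rightarrow> real" where
  "squash s = enn2real (inverse (1 + s))"

definition unsquash :: "real \<Rightarrow> ennreal" where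
  "unsquash u = inverse (ennreal u) - 1"

lemma squash_ennreal: "0 \<le> r \<Longrightarrow> squash (ennreal r) = 1 / (1 + r)"
  by (simp add: squash_def inverse_ennreal ennreal_plus[symmetric] ennreal_1[symmetric]
      inverse_eq_divide del: ennreal_plus ennreal_1)

lemma squash_top: "squash top = 0"
  by (simp add: squash_def)

lemma squash_bounds: "0 \<le> squash s" "squash s \<le> 1"
  by (cases s; simp add: squash_ennreal squash_top)+

lemma unsquash_squash: "unsquash (squash s) = s"
proof (cases s)
  case (real r)
  then have "unsquash (squash s) = ennreal (1 + r) - ennreal 1"
    by (simp add: unsquash_def squash_ennreal inverse_ennreal)
  also have "\<dots> = s" using real by (subst ennreal_minus) auto
  finally show ?thesis .
qed (simp add: unsquash_def squash_top)

text \<open>The map \<open>1 / (1 + s)\<close> is 1-Lipschitz on the finite half-line; estimates of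
  waiting times as real numbers thus become estimates for \<open>close\<close>.\<close>

lemma squash_diff_le:
  assumes "a \<noteq> \<infinity>" "b \<noteq> \<infinity>"
  shows "\<bar>squash a - squash b\<bar> \<le> \<bar>enn2real a - enn2real b\<bar>"
proof -
  obtain r where r: "a = ennreal r" "0 \<le> r" using assms by (cases a) auto
  obtain t where t: "b = ennreal t" "0 \<le> t" using assms by (cases b) auto
  have "squash a - squash b = (t - r) / ((1 + r) * (1 + t))"
    using r t by (simp add: squash_ennreal field_simps)
  also have "\<bar>\<dots>\<bar> \<le> \<bar>t - r\<bar>"
  proof -
    have "1 * 1 \<le> (1 + r) * (1 + t)" using r t by (intro mult_mono) auto
    then show ?thesis using mult_left_mono[of 1 "(1+r)*(1+t)" "\<bar>t - r\<bar>"] 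
      by (auto simp: divide_le_eq abs_mult)
  qed
  finally show ?thesis using r t by simp
qed

lemma continuous_on_squash: "continuous_on S squash"
  unfolding continuous_on_def
proof
  fix x :: ennreal
  \<comment> \<open>\<open>enn2real\<close> jumps at \<open>top\<close>, but
    \<open>inverse (1 + s)\<close> is at most 1 and stays away from it.\<close>
  have "continuous_on UNIV (\<lambda>s::ennreal. inverse (1 + s))"
    by (intro continuous_on_inverse_ennreal continuous_on_add_ennreal continuous_on_const continuous_on_id)
  then have "((\<lambda>s. inverse (1 + s)) \<longlongrightarrow> inverse (1 + x)) (at x within S)"
    unfolding continuous_on_def by (meson UNIV_I tendsto_within_subset subset_UNIV)
  then have "((\<lambda>s. enn2real (inverse (1 + s))) \<longlongrightarrow> enn2real (inverse (1 + x))) (at x within S)"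
    by (intro tendsto_enn2real) (simp_all add: less_top[symmetric])
  then show "(squash \<longlongrightarrow> squash x) (at x within S)"
    by (simp add: squash_def[abs_def])
qed

text \<open>Truncated subtraction of 1 is monotone and onto, hence continuous. Arguments
  \<open>u \<le> 0\<close> are sent to \<open>top\<close>, so continuity holds on the whole real
  line.\<close>

lemma continuous_on_unsquash: "continuous_on S unsquash"
proof -
  have "range (\<lambda>s::ennreal. s - 1) = UNIV"
    by (rule surjI[where f="\<lambda>s. s + 1"]) simp
  then have "continuous_on UNIV (\<lambda>s::ennreal. s - 1)"
    by (intro continuous_onI_mono) (auto intro: ennreal_minus_mono)
  moreover have "continuous_on S (\<lambda>u. inverse (ennreal u))"
    by (intro continuous_on_inverse_ennreal continuous_on_ennreal continuous_on_id)
  ultimately show ?thesis unfolding unsquash_def[abs_def]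
    by (rule continuous_on_compose2) auto
qed

text \<open>Finitely many coordinates describe a uniform neighbourhood in the product. The second
  components have to agree exactly, because both comparisons leave the observed values unchanged off
  a small set.\<close>

definition close :: "real \<Rightarrow> nat \<Rightarrow> (nat \<Rightarrow> ennreal) \<times> 'b \<Rightarrow> (nat \<Rightarrow> ennreal) \<times> 'b \<Rightarrow> bool" where
  "close d K a b \<longleftrightarrow> snd a = snd b \<and> (\<forall>k\<le>K. \<bar>squash (fst a k) - squash (fst b k)\<bar> < d)"

section \<open>Compactness and uniform continuity for pairs of sequences\<close>

lemma compact_UNIV_fun:
  assumes "compact (UNIV :: 'f::topological_space set)"
  shows "compact (UNIV :: ('i \<Rightarrow> 'f) set)"
proof -
  have "compact_space (product_topology (\<lambda>_::'i. euclidean :: 'f topology) UNIV)"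
    using assms by (subst compact_space_product_topology) (auto simp: compact_space_def)
  then show ?thesis by (simp add: euclidean_product_topology compact_space_def)
qed

lemma compact_unit_cube: "compact {u :: 'i \<Rightarrow> real. \<forall>k. 0 \<le> u k \<and> u k \<le> 1}"
proof -
  have "compactin (product_topology (\<lambda>_::'i. euclidean :: real topology) UNIV) (PiE UNIV (\<lambda>_. {0..1}))"
    by (subst compactin_PiE) (auto simp: PiE_eq_empty_iff)
  moreover have "PiE UNIV (\<lambda>_. {0..1}) = {u :: 'i \<Rightarrow> real. \<forall>k. 0 \<le> u k \<and> u k \<le> 1}"
    by (auto simp: PiE_def Pi_def)
  ultimately show ?thesis by (simp add: euclidean_product_topology)
qed

lemma dist_fun_less_if_initial_coordinates_close:
  fixes e :: real
  assumes "0 < e"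
  obtains d K where "0 < d"
    "\<And>u v :: nat \<Rightarrow> 'b::metric_space. (\<And>k. k \<le> K \<Longrightarrow> dist (u k) (v k) < d) \<Longrightarrow> dist u v < e"
proof -
  obtain N where N: "(1 / 2 :: real) ^ N < e / 2"
    using real_arch_pow_inv[of "e / 2" "1 / 2"] assms by auto
  \<comment> \<open>The distance of two sequences is at most twice the maximal distance over the
    indices enumerated up to \<open>N\<close>, plus \<open>(1 / 2) ^ N\<close>. Hence
    \<open>K\<close> has to cover these indices, and \<open>e / 4\<close> is small enough.\<close>
  define K :: nat where "K = Max (from_nat ` {..N})"
  have K: "from_nat n \<le> K" if "n \<le> N" for n
    unfolding K_def using that by (intro Max_ge) auto
  show ?thesis
  proof (rule that[of "e / 4" K])
    fix u v :: "nat \<Rightarrow> 'b" assume close: "\<And>k. k \<le> K \<Longrightarrow> dist (u k) (v k) < e / 4"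
    let ?D = "{dist (u (from_nat n)) (v (from_nat n)) |n. n \<le> N}"
    have "finite ?D" "?D \<noteq> {}" by auto
    then have "Max ?D < e / 4" using close K by (subst Max_less_iff) auto
    then show "dist u v < e" using dist_fun_le_dist_first_terms[of u v N] N by linarith
  qed (use assms in simp)
qed

text \<open>\<open>squash\<close> carries the pairs into the compact metric space \<open>C\<close>,
  on which \<open>F\<close>, the function \<open>f\<close> read through \<open>unsquash\<close>, is
  uniformly continuous.\<close>

lemma continuous_uniform_close:
  fixes f :: "(nat \<Rightarrow> ennreal) \<times> (nat \<Rightarrow> 'f::metric_space) \<Rightarrow> real"
  assumes F: "compact (UNIV :: 'f set)" and f: "continuous_on UNIV f" and e: "0 < e"
  obtains d K where "0 < d" "\<And>a b. close d K a b \<Longrightarrow> \<bar>f a - f b\<bar> < e"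
proof -
  define C where "C = {u :: nat \<Rightarrow> real. \<forall>k. 0 \<le> u k \<and> u k \<le> 1} \<times> (UNIV :: (nat \<Rightarrow> 'f) set)"
  define F where "F = (\<lambda>p :: (nat \<Rightarrow> real) \<times> (nat \<Rightarrow> 'f). f (\<lambda>k. unsquash (fst p k), snd p))"
  have "continuous_on UNIV F"
    unfolding F_def
  proof (rule continuous_on_compose2[OF f])
    show "continuous_on UNIV (\<lambda>p :: (nat \<Rightarrow> real) \<times> (nat \<Rightarrow> 'f). (\<lambda>k. unsquash (fst p k), snd p))"
    proof (rule continuous_on_Pair[OF continuous_on_coordinatewise_then_product continuous_on_snd[OF continuous_on_id]])
      fix k
      have "continuous_on UNIV (\<lambda>p :: (nat \<Rightarrow> real) \<times> (nat \<Rightarrow> 'f). fst p k)"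
        by (rule continuous_on_product_then_coordinatewise[OF continuous_on_fst[OF continuous_on_id]])
      then show "continuous_on UNIV (\<lambda>p :: (nat \<Rightarrow> real) \<times> (nat \<Rightarrow> 'f). unsquash (fst p k))"
        by (rule continuous_on_compose2[OF continuous_on_unsquash]) auto
    qed
  qed auto
  moreover have "compact C"
    unfolding C_def by (intro compact_Times compact_unit_cube compact_UNIV_fun F)
  ultimately have "uniformly_continuous_on C F"
    by (intro compact_uniformly_continuous) (auto intro: continuous_on_subset)
  then obtain d' where d': "0 < d'" "\<And>p q. p \<in> C \<Longrightarrow> q \<in> C \<Longrightarrow> dist q p < d' \<Longrightarrow> dist (F q) (F p) < e"
    using e unfolding uniformly_continuous_on_def by metis
  obtain d K where dK: "0 < d"
    "\<And>u v :: nat \<Rightarrow> real. (\<And>k. k \<le> K \<Longrightarrow> dist (u k) (v k) < d) \<Longrightarrow> dist u v < d'"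
    using dist_fun_less_if_initial_coordinates_close[OF d'(1)] by metis
  show ?thesis
  proof (rule that[OF dK(1)])
    fix a b :: "(nat \<Rightarrow> ennreal) \<times> (nat \<Rightarrow> 'f)" assume ab: "close d K a b"
    define E where "E = (\<lambda>a :: (nat \<Rightarrow> ennreal) \<times> (nat \<Rightarrow> 'f). (\<lambda>k. squash (fst a k), snd a))"
    have E: "E a \<in> C" "F (E a) = f a" for a
      by (auto simp: E_def C_def F_def squash_bounds unsquash_squash)
    have "dist (E a) (E b) = dist (fst (E a)) (fst (E b))"
      using ab by (simp add: E_def close_def dist_Pair_Pair)
    also have "\<dots> < d'"
      using ab by (intro dK(2)) (auto simp: E_def close_def dist_real_def)
    finally have "dist (F (E a)) (F (E b)) < e" using d'(2) E by blast
    then show "\<bar>f a - f b\<bar> < e" by (simp add: E dist_real_def)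
  qed
qed

text \<open>Let \<open>b\<close> run through a countable basis of the first factor. An open
  \<open>W\<close> is the union of the rectangles \<open>b \<times> V b\<close>, where
  \<open>V b\<close> is the largest open set with \<open>b \<times> V b \<subseteq> W\<close>; so
  countably many rectangles suffice.\<close>

lemma borel_measurable_Pair_second_countable:
  fixes f :: "'a \<Rightarrow> 'b::second_countable_topology" and g :: "'a \<Rightarrow> 'c::topological_space"
  assumes f [measurable]: "f \<in> borel_measurable M" and g [measurable]: "g \<in> borel_measurable M"
  shows "(\<lambda>x. (f x, g x)) \<in> borel_measurable M"
proof (rule borel_measurableI)
  fix W :: "('b \<times> 'c) set" assume W: "open W"
  obtain B :: "'b set set" where B: "countable B" "topological_basis B"
    using ex_countable_basis by blast
  define V where "V b = \<Union>{V. open V \<and> b \<times> V \<subseteq> W}" for b :: "'b set"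
  have V: "open (V b)" for b by (auto simp: V_def)
  have "W = (\<Union>b\<in>B. b \<times> V b)"
  proof (intro set_eqI iffI)
    fix p assume p: "p \<in> W"
    obtain U V' where UV: "open U" "open V'" "p \<in> U \<times> V'" "U \<times> V' \<subseteq> W"
      using open_prod_elim[OF W p] by blast
    obtain b where b: "b \<in> B" "fst p \<in> b" "b \<subseteq> U"
      using topological_basisE[OF B(2) UV(1)] UV(3) by (metis mem_Times_iff)
    have "snd p \<in> V b" using UV b unfolding V_def by fastforce
    then show "p \<in> (\<Union>b\<in>B. b \<times> V b)" using b by (auto simp: mem_Times_iff)
  qed (auto simp: V_def)
  then have "(\<lambda>x. (f x, g x)) -` W \<inter> space M = (\<Union>b\<in>B. (f -` b \<inter> space M) \<inter> (g -` V b \<inter> space M))"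
    by auto
  also have "\<dots> \<in> sets M"
    using B V by (auto intro!: sets.countable_UN' sets.Int measurable_sets[OF f] measurable_sets[OF g]
      intro: borel_open topological_basis_open)
  finally show "(\<lambda>x. (f x, g x)) -` W \<inter> space M \<in> sets M" .
qed

text \<open>The value of \<open>distr\<close> on a set is the measure of the preimage, or 0 if these
  values form no measure. Some set and its complement both have non-measurable preimages, which
  count as 0, so additivity leaves total mass 0.\<close>

lemma emeasure_distr_not_measurable:
  assumes X: "X \<in> space M \<rightarrow> space N" "X \<notin> measurable M N"
  shows "emeasure (distr M N X) (space N) = 0"
proof -
  let ?D = "distr M N X" and ?\<mu> = "\<lambda>A. emeasure M (X -` A \<inter> space M)"
  obtain B where B: "B \<in> sets N" "X -` B \<inter> space M \<notin> sets M"
    using X unfolding measurable_def by (auto simp: Pi_iff)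
  have "X -` (space N - B) \<inter> space M \<notin> sets M"
  proof
    assume "X -` (space N - B) \<inter> space M \<in> sets M"
    then have "space M - (X -` (space N - B) \<inter> space M) \<in> sets M" by auto
    also have "space M - (X -` (space N - B) \<inter> space M) = X -` B \<inter> space M"
      using X sets.sets_into_space[OF B(1)] by auto
    finally show False using B by simp
  qed
  then have zero: "?\<mu> B = 0" "?\<mu> (space N - B) = 0"
    using B by (auto simp: emeasure_notin_sets)
  have D: "emeasure ?D A = (if measure_space (space N) (sets N) ?\<mu> \<and> A \<in> sets N then ?\<mu> A else 0)" for A
    by (auto simp: distr_def emeasure_measure_of_conv sets.sigma_sets_eq)
  have "emeasure ?D (space N) = emeasure ?D B + emeasure ?D (space N - B)"
    using B sets.sets_into_space[OF B(1)] by (subst plus_emeasure) (auto simp: Un_absorb1)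
  also have "\<dots> = 0" using zero by (simp add: D)
  finally show ?thesis .
qed

section \<open>Hitting times and visit counts\<close>

lemma hit_eq_enat_iff:
  "hit S A x = enat n \<longleftrightarrow> 1 \<le> n \<and> (S ^^ n) x \<in> A \<and> (\<forall>m. 1 \<le> m \<longrightarrow> m < n \<longrightarrow> (S ^^ m) x \<notin> A)"
  (is "?l \<longleftrightarrow> ?r")
proof
  assume ?l
  then have ex: "\<exists>n\<ge>1. (S ^^ n) x \<in> A" and n: "n = (LEAST n. n \<ge> 1 \<and> (S ^^ n) x \<in> A)"
    by (auto simp: hit_def split: if_splits)
  then show ?r
    using LeastI_ex[of "\<lambda>n. n \<ge> 1 \<and> (S ^^ n) x \<in> A"] not_less_Least[of _ "\<lambda>n. n \<ge> 1 \<and> (S ^^ n) x \<in> A"]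
    by blast
next
  assume r: ?r
  then have "(LEAST n. n \<ge> 1 \<and> (S ^^ n) x \<in> A) = n"
    by (intro Least_equality) (auto simp: not_less[symmetric])
  then show ?l using r by (auto simp: hit_def)
qed

lemma hit_eq_infinity_iff: "hit S A x = \<infinity> \<longleftrightarrow> (\<forall>n\<ge>1. (S ^^ n) x \<notin> A)"
  by (auto simp: hit_def)

lemma hit_finiteE:
  assumes "1 \<le> n" "(S ^^ n) x \<in> A"
  obtains m where "hit S A x = enat m" "1 \<le> m" "m \<le> n"
proof -
  have "hit S A x \<noteq> \<infinity>" using assms by (auto simp: hit_eq_infinity_iff)
  then obtain m where m: "hit S A x = enat m" by auto
  then have "1 \<le> m" "m \<le> n" using assms by (auto simp: hit_eq_enat_iff not_less[symmetric])
  then show ?thesis using m that by blast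
qed

lemma hit_unfold: "hit S A x = (if S x \<in> A then 1 else eSuc (hit S A (S x)))"
proof (cases "S x \<in> A")
  case True
  then have "hit S A x = enat 1" by (subst hit_eq_enat_iff) auto
  then show ?thesis using True by (simp add: one_enat_def)
next
  case False
  have shift: "(S ^^ Suc n) x = (S ^^ n) (S x)" for n by (simp add: funpow_swap1)
  show ?thesis
  proof (cases "hit S A (S x)")
    case (enat n)
    have "hit S A x = enat (Suc n)"
      unfolding hit_eq_enat_iff
    proof (intro conjI allI impI)
      show "(S ^^ Suc n) x \<in> A" using enat unfolding shift hit_eq_enat_iff by blast
      fix m assume m: "1 \<le> m" "m < Suc n"
      show "(S ^^ m) x \<notin> A"
      proof (cases "m = 1")
        case False
        then obtain j where "m = Suc j" "1 \<le> j" "j < n" using m by (cases m) auto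
        then show ?thesis using enat unfolding \<open>m = Suc j\<close> shift hit_eq_enat_iff by blast
      qed (use \<open>S x \<notin> A\<close> in simp)
    qed simp
    then show ?thesis using enat False by (simp add: eSuc_enat)
  next
    case infinity
    have "(S ^^ n) x \<notin> A" if n: "1 \<le> n" for n
    proof (cases "n = 1")
      case False
      then obtain j where "n = Suc j" "1 \<le> j" using n by (cases n) auto
      then show ?thesis using infinity unfolding \<open>n = Suc j\<close> shift hit_eq_infinity_iff by blast
    qed (use \<open>S x \<notin> A\<close> in simp)
    then have "hit S A x = \<infinity>" by (simp add: hit_eq_infinity_iff)
    then show ?thesis using infinity False by simp
  qed
qed

lemma retmap_eq: "hit S A x = enat n \<Longrightarrow> retmap S A x = (S ^^ n) x"
  by (simp add: retmap_def)

lemma hit_step: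
  assumes "hit S A x = enat n" "n \<noteq> 1"
  shows "hit S A (S x) = enat (n - 1)" "2 \<le> n"
proof -
  have n: "1 \<le> n" using assms by (simp add: hit_eq_enat_iff)
  have "S x \<notin> A"
  proof
    assume "S x \<in> A"
    then have "hit S A x = enat 1" by (subst hit_unfold) (simp add: one_enat_def)
    then show False using assms by simp
  qed
  then have "eSuc (hit S A (S x)) = enat n" using assms hit_unfold[of S A x] by simp
  then show "hit S A (S x) = enat (n - 1)"
    by (cases "hit S A (S x)") (auto simp: eSuc_enat)
  show "2 \<le> n" using n assms by simp
qed

lemma retmap_step:
  assumes "hit S A x = enat n" "n \<noteq> 1"
  shows "retmap S A (S x) = retmap S A x"
proof -
  obtain m where "n = Suc m" using hit_step(2)[OF assms] by (cases n) auto
  then show ?thesis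
    using retmap_eq[OF assms(1)] retmap_eq[OF hit_step(1)[OF assms]] by (simp add: funpow_swap1)
qed

text \<open>For this reason a step of \<open>T\<close> that misses \<open>A\<close> affects only the
  first waiting time. The local process reads the iterates from index 1 on and does not change at
  all.\<close>

lemma retmap_iterate_step:
  assumes "hit S A x = enat n" "n \<noteq> 1"
  shows "(retmap S A ^^ Suc k) (S x) = (retmap S A ^^ Suc k) x"
  using retmap_step[OF assms] by (simp only: funpow_Suc_right comp_apply)

text \<open>Time 0 is left out and time \<open>n\<close> included, in accordance with
  \<open>hit\<close>; counts over consecutive blocks then add up.\<close>

definition visits :: "('a \<Rightarrow> 'a) \<Rightarrow> 'a set \<Rightarrow> nat \<Rightarrow> 'a \<Rightarrow> nat" where
  "visits T Y n x = (\<Sum>j<n. indicator Y ((T ^^ Suc j) x))"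

lemma visits_add: "visits T Y (m + n) x = visits T Y m x + visits T Y n ((T ^^ m) x)"
proof (induction n)
  case (Suc n)
  have "(T ^^ Suc (m + n)) x = (T ^^ Suc n) ((T ^^ m) x)"
    by (subst funpow_add[THEN fun_cong, symmetric, unfolded comp_apply]) (simp add: add.commute)
  then show ?case using Suc by (simp add: visits_def)
qed (simp add: visits_def)

lemma visits_hit:
  assumes "hit T Y x = enat m"
  shows "visits T Y m x = 1"
proof -
  obtain j where m: "m = Suc j" using assms by (cases m) (auto simp: hit_eq_enat_iff)
  have "(T ^^ Suc i) x \<notin> Y" if "i < j" for i
    using assms that unfolding hit_eq_enat_iff m by (auto simp del: funpow.simps)
  moreover have "(T ^^ Suc j) x \<in> Y" using assms unfolding hit_eq_enat_iff m by blast
  ultimately show ?thesis by (simp add: visits_def m del: funpow.simps)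
qed

text \<open>Since \<open>A \<subseteq> Y\<close>, the orbit meets \<open>Y\<close> at some first
  time \<open>m \<le> n\<close>. Either \<open>m = n\<close> and the return map enters
  \<open>A\<close> in one step, or the argument restarts at \<open>(T ^^ m) x\<close> with
  \<open>n - m\<close> steps left and one visit already counted.\<close>

lemma hit_retmap_eq_visits:
  assumes "A \<subseteq> Y" "hit T A x = enat n"
  shows "hit (retmap T Y) A x = enat (visits T Y n x)"
  using assms(2)
proof (induction n arbitrary: x rule: less_induct)
  case (less n)
  then have n: "1 \<le> n" "(T ^^ n) x \<in> A" by (auto simp: hit_eq_enat_iff)
  then obtain m where m: "hit T Y x = enat m" "1 \<le> m" "m \<le> n"
    using assms(1) by (elim hit_finiteE[of n T x Y]) auto
  have TY: "retmap T Y x = (T ^^ m) x" by (rule retmap_eq[OF m(1)])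
  show ?case
  proof (cases "m = n")
    case True
    then show ?thesis
      using n visits_hit[OF m(1)] by (subst hit_unfold) (simp add: TY one_enat_def)
  next
    case False
    then have "m < n" using m by simp
    have notA: "(T ^^ m) x \<notin> A" using less.prems m \<open>m < n\<close> by (auto simp: hit_eq_enat_iff)
    have "hit T A ((T ^^ m) x) = enat (n - m)"
      unfolding hit_eq_enat_iff
    proof (intro conjI allI impI)
      have app: "(T ^^ i) ((T ^^ m) x) = (T ^^ (i + m)) x" for i by (simp add: funpow_add)
      show "(T ^^ (n - m)) ((T ^^ m) x) \<in> A" unfolding app using n m by simp
      fix i assume "1 \<le> i" "i < n - m"
      then show "(T ^^ i) ((T ^^ m) x) \<notin> A"
        using less.prems unfolding app hit_eq_enat_iff by auto
    qed (use \<open>m < n\<close> in simp)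
    then have "hit (retmap T Y) A ((T ^^ m) x) = enat (visits T Y (n - m) ((T ^^ m) x))"
      using m n by (intro less.IH) auto
    moreover have "visits T Y n x = Suc (visits T Y (n - m) ((T ^^ m) x))"
      using visits_add[of T Y m "n - m" x] visits_hit[OF m(1)] m by simp
    ultimately show ?thesis using notA by (subst hit_unfold) (simp add: TY eSuc_enat)
  qed
qed

text \<open>Recurrence makes every waiting time along the orbit finite, so \<open>retmap\<close>
  never falls back on its default value and the exponents of \<open>T\<close> add up.\<close>

lemma recurrent_iterates:
  assumes "\<And>N. \<exists>n\<ge>N. (T ^^ n) x \<in> A"
  shows "(retmap T A ^^ k) x = (T ^^ (\<Sum>i<k. the_enat (hit T A ((retmap T A ^^ i) x)))) x"
    and "hit T A ((retmap T A ^^ k) x) \<noteq> \<infinity>"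
proof -
  have fin: "hit T A ((T ^^ m) x) \<noteq> \<infinity>" for m
  proof -
    obtain n where "n \<ge> Suc m" "(T ^^ n) x \<in> A" using assms by blast
    then have "1 \<le> n - m" "(T ^^ (n - m)) ((T ^^ m) x) \<in> A"
      by (auto simp: funpow_add[THEN fun_cong, symmetric, unfolded comp_apply])
    then show ?thesis by (auto simp: hit_eq_infinity_iff)
  qed
  show eq: "(retmap T A ^^ k) x = (T ^^ (\<Sum>i<k. the_enat (hit T A ((retmap T A ^^ i) x)))) x" for k
  proof (induction k)
    case (Suc k)
    obtain n where "hit T A ((retmap T A ^^ k) x) = enat n" using fin unfolding Suc by auto
    then show ?case using Suc by (simp add: retmap_eq funpow_add add.commute)
  qed simp
  show "hit T A ((retmap T A ^^ k) x) \<noteq> \<infinity>" using fin by (subst eq)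
qed

text \<open>The identity for a single waiting time is summed over the blocks between successive
  visits to \<open>A\<close>. Thus the \<open>k\<close>-th visit times of the two systems are linked
  by counting visits to \<open>Y\<close>, which is what Birkhoff averages control.\<close>

lemma recurrent_visits:
  assumes io: "\<And>N. \<exists>n\<ge>N. (T ^^ n) x \<in> A" and "A \<subseteq> Y"
  shows "hit (retmap T Y) A ((retmap T A ^^ k) x) \<noteq> \<infinity>"
    and "(\<Sum>i<k. the_enat (hit (retmap T Y) A ((retmap T A ^^ i) x)))
      = visits T Y (\<Sum>i<k. the_enat (hit T A ((retmap T A ^^ i) x))) x"
proof -
  have hit: "hit (retmap T Y) A ((retmap T A ^^ k) x)
      = enat (visits T Y (the_enat (hit T A ((retmap T A ^^ k) x))) ((retmap T A ^^ k) x))" for k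
    using recurrent_iterates(2)[OF io, of k] by (intro hit_retmap_eq_visits[OF assms(2)]) auto
  show "hit (retmap T Y) A ((retmap T A ^^ k) x) \<noteq> \<infinity>" by (simp add: hit)
  show "(\<Sum>i<k. the_enat (hit (retmap T Y) A ((retmap T A ^^ i) x)))
      = visits T Y (\<Sum>i<k. the_enat (hit T A ((retmap T A ^^ i) x))) x"
  proof (induction k)
    case (Suc k)
    then show ?case
      by (simp add: hit visits_add recurrent_iterates(1)[OF io, of k, symmetric])
  qed (simp add: visits_def)
qed

section \<open>Measurability of hitting times and return maps\<close>

lemma hit_measurable:
  assumes S [measurable]: "S \<in> measurable M M" and A [measurable]: "A \<in> sets M"
  shows "hit S A \<in> measurable M (count_space UNIV)"
proof -
  have pow [measurable]: "S ^^ n \<in> measurable M M" for n by (rule measurable_compose_n) measurable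
  have "hit S A -` {a} \<inter> space M \<in> sets M" for a
  proof (cases a)
    case (enat n)
    have "hit S A -` {a} \<inter> space M = {x \<in> space M. 1 \<le> n \<and> (S ^^ n) x \<in> A \<and> (\<forall>m. 1 \<le> m \<longrightarrow> m < n \<longrightarrow> (S ^^ m) x \<notin> A)}"
      unfolding enat hit_eq_enat_iff[symmetric] by auto
    also have "\<dots> \<in> sets M" by measurable
    finally show ?thesis .
  next
    case infinity
    have "hit S A -` {a} \<inter> space M = {x \<in> space M. \<forall>n. 1 \<le> n \<longrightarrow> (S ^^ n) x \<notin> A}"
      unfolding infinity using hit_eq_infinity_iff[of S A] by auto
    also have "\<dots> \<in> sets M" by measurable
    finally show ?thesis .
  qed
  then show ?thesis by (subst measurable_count_space_eq2_countable) auto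
qed

lemma retmap_measurable:
  assumes S [measurable]: "S \<in> measurable M M" and A [measurable]: "A \<in> sets M"
  shows "retmap S A \<in> measurable M M"
proof -
  have pow: "S ^^ n \<in> measurable M M" for n by (rule measurable_compose_n) measurable
  have "(\<lambda>x. (\<lambda>h x. case h of enat n \<Rightarrow> (S ^^ n) x | \<infinity> \<Rightarrow> x) (hit S A x) x) \<in> measurable M M"
  proof (rule measurable_compose_countable'[OF _ hit_measurable[OF S A]])
    fix h :: enat
    show "(\<lambda>x. case h of enat n \<Rightarrow> (S ^^ n) x | \<infinity> \<Rightarrow> x) \<in> measurable M M"
      using pow by (cases h) auto
  qed simp
  then show ?thesis by (simp add: retmap_def[abs_def])
qed

lemma scaled_hits_measurable:
  assumes S: "S \<in> measurable M M" and U: "U \<in> measurable M M" and A: "A \<in> sets M"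
  shows "(\<lambda>x k. c * ennreal_of_enat (hit S A ((U ^^ k) x))) \<in> borel_measurable M"
proof (rule measurable_coordinatewise_then_product)
  fix k
  have "U ^^ k \<in> measurable M M" using U by (rule measurable_compose_n)
  then have [measurable]: "(\<lambda>x. hit S A ((U ^^ k) x)) \<in> measurable M (count_space UNIV)"
    by (rule measurable_compose[OF _ hit_measurable[OF S A]])
  show "(\<lambda>x. c * ennreal_of_enat (hit S A ((U ^^ k) x))) \<in> borel_measurable M"
    by measurable
qed

lemma scaled_Phi_measurable:
  assumes "T \<in> measurable M M" "A \<in> sets M"
  shows "scaled_Phi M T A \<in> borel_measurable M"
  using scaled_hits_measurable[OF assms(1) retmap_measurable[OF assms] assms(2)]
  by (simp add: scaled_Phi_def[abs_def])

lemma scaled_Phi_Y_measurable: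
  assumes "T \<in> measurable M M" "A \<in> sets M" "Y \<in> sets M"
  shows "scaled_Phi_Y M T Y A \<in> borel_measurable M"
  using scaled_hits_measurable[OF retmap_measurable[OF assms(1,3)] retmap_measurable[OF assms(1,2)] assms(2)]
  by (simp add: scaled_Phi_Y_def[abs_def])

section \<open>Convergence in law\<close>

lemma conv_in_law_iff:
  assumes "\<And>l. X l \<in> borel_measurable \<nu>" "Z \<in> borel_measurable P"
  shows "conv_in_law \<nu> X P Z \<longleftrightarrow> (\<forall>f :: _ \<Rightarrow> real. continuous_on UNIV f \<longrightarrow> bounded (range f) \<longrightarrow>
    (\<lambda>l. \<integral>x. f (X l x) \<partial>\<nu>) \<longlonglongrightarrow> (\<integral>\<omega>. f (Z \<omega>) \<partial>P))"
proof -
  have "integral\<^sup>L (distr \<nu> borel (X l)) f = (\<integral>x. f (X l x) \<partial>\<nu>)"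
    if "continuous_on UNIV f" for f :: "_ \<Rightarrow> real" and l
    using assms that by (intro integral_distr borel_measurable_continuous_onI)
  moreover have "integral\<^sup>L (distr P borel Z) f = (\<integral>\<omega>. f (Z \<omega>) \<partial>P)"
    if "continuous_on UNIV f" for f :: "_ \<Rightarrow> real"
    using assms that by (intro integral_distr borel_measurable_continuous_onI)
  ultimately show ?thesis by (auto simp: conv_in_law_def weak_conv_def)
qed

text \<open>Testing with the constant 1 shows that the total masses tend to 1, whereas the law of a
  non-measurable map has mass 0.\<close>

lemma conv_in_law_eventually_measurable:
  assumes "conv_in_law \<nu> X P Z" "prob_space P" "Z \<in> borel_measurable P"
  shows "\<forall>\<^sub>F l in sequentially. X l \<in> borel_measurable \<nu>"
proof -
  have "prob_space (distr P borel Z)" using assms by (simp add: prob_space.prob_space_distr)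
  then have "integral\<^sup>L (distr P borel Z) (\<lambda>_. 1 :: real) = 1"
    using prob_space.prob_space[of "distr P borel Z"] by simp
  then have "(\<lambda>l. integral\<^sup>L (distr \<nu> borel (X l)) (\<lambda>_. 1 :: real)) \<longlonglongrightarrow> 1"
    using assms(1)[unfolded conv_in_law_def weak_conv_def, rule_format, of "\<lambda>_. 1"]
    by (auto simp: image_constant_conv)
  then have "\<forall>\<^sub>F l in sequentially. 0 < integral\<^sup>L (distr \<nu> borel (X l)) (\<lambda>_. 1 :: real)"
    by (rule order_tendstoD) simp
  then show ?thesis
  proof eventually_elim
    case (elim l)
    show ?case
    proof (rule ccontr)
      assume "X l \<notin> borel_measurable \<nu>"
      then have "emeasure (distr \<nu> borel (X l)) (space borel) = 0"
        by (intro emeasure_distr_not_measurable) auto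
      then show False using elim by (simp add: measure_def)
    qed
  qed
qed

lemma conv_in_law_shift: "conv_in_law \<nu> (\<lambda>l. X (l + n)) P Z \<longleftrightarrow> conv_in_law \<nu> X P Z"
proof -
  have "(\<lambda>l. integral\<^sup>L (distr \<nu> borel (X (l + n))) f) \<longlonglongrightarrow> c \<longleftrightarrow>
      (\<lambda>l. integral\<^sup>L (distr \<nu> borel (X l)) f) \<longlonglongrightarrow> c" for f :: "_ \<Rightarrow> real" and c
    using LIMSEQ_ignore_initial_segment[of "\<lambda>l. integral\<^sup>L (distr \<nu> borel (X l)) f" c n]
      LIMSEQ_offset[of "\<lambda>l. integral\<^sup>L (distr \<nu> borel (X l)) f" n c] by blast
  then show ?thesis by (simp add: conv_in_law_def weak_conv_def)
qed

section \<open>Closeness in probability and bounded continuous test functions\<close>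

lemma (in prob_space) L1_tendsto_0_if_close:
  fixes R R' :: "nat \<Rightarrow> 'a \<Rightarrow> (nat \<Rightarrow> ennreal) \<times> (nat \<Rightarrow> 'f::metric_space)" and f :: "_ \<Rightarrow> real"
  assumes F: "compact (UNIV :: 'f set)" and f: "continuous_on UNIV f" "bounded (range f)"
    and R: "\<And>l. R l \<in> borel_measurable M" and R': "\<And>l. R' l \<in> borel_measurable M"
    and close: "\<And>d K e. 0 < d \<Longrightarrow> 0 < e \<Longrightarrow> \<forall>\<^sub>F l in sequentially.
      \<exists>B\<in>sets M. prob B < e \<and> (\<forall>x\<in>space M - B. close d K (R l x) (R' l x))"
  shows "(\<lambda>l. \<integral>x. \<bar>f (R l x) - f (R' l x)\<bar> \<partial>M) \<longlonglongrightarrow> 0"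
proof (rule tendstoI)
  fix e :: real assume e: "0 < e"
  obtain C where C: "\<And>z. \<bar>f z\<bar> \<le> C" "0 < C"
    using f(2) unfolding bounded_pos by auto
  obtain d K where dK: "0 < d" "\<And>a b. close d K a b \<Longrightarrow> \<bar>f a - f b\<bar> < e / 2"
    using continuous_uniform_close[OF F f(1), of "e / 2"] e by auto
  have [measurable]: "(\<lambda>x. f (R l x)) \<in> borel_measurable M" "(\<lambda>x. f (R' l x)) \<in> borel_measurable M" for l
    using measurable_compose[OF R borel_measurable_continuous_onI[OF f(1)]]
      measurable_compose[OF R' borel_measurable_continuous_onI[OF f(1)]] by auto
  have bound: "\<bar>f a - f b\<bar> \<le> 2 * C" for a b using C(1)[of a] C(1)[of b] by linarith
  \<comment> \<open>Off \<open>B\<close> the integrand is below \<open>e / 2\<close>; on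
    \<open>B\<close> it is at most \<open>2 * C\<close>, which contributes less than another
    \<open>e / 2\<close>.\<close>
  have "\<forall>\<^sub>F l in sequentially. \<exists>B\<in>sets M. prob B < e / (4 * C) \<and> (\<forall>x\<in>space M - B. close d K (R l x) (R' l x))"
    using dK e C by (intro close) auto
  then show "\<forall>\<^sub>F l in sequentially. dist (\<integral>x. \<bar>f (R l x) - f (R' l x)\<bar> \<partial>M) 0 < e"
  proof eventually_elim
    case (elim l)
    then obtain B where B [measurable]: "B \<in> sets M" and pB: "prob B < e / (4 * C)"
      and cl: "\<And>x. x \<in> space M \<Longrightarrow> x \<notin> B \<Longrightarrow> close d K (R l x) (R' l x)" by auto
    have "(\<integral>x. \<bar>f (R l x) - f (R' l x)\<bar> \<partial>M) \<le> (\<integral>x. e / 2 + 2 * C * indicator B x \<partial>M)"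
    proof (rule integral_mono)
      show "integrable M (\<lambda>x. \<bar>f (R l x) - f (R' l x)\<bar>)"
        by (rule integrable_const_bound[where B="2 * C"]) (auto simp: bound)
      show "integrable M (\<lambda>x. e / 2 + 2 * C * indicator B x)"
        by (rule integrable_const_bound[where B="e / 2 + 2 * C"]) (use e C in \<open>auto simp: indicator_def\<close>)
      fix x assume "x \<in> space M"
      then show "\<bar>f (R l x) - f (R' l x)\<bar> \<le> e / 2 + 2 * C * indicator B x"
        using bound[of "R l x" "R' l x"] dK(2)[OF cl[of x]] e by (cases "x \<in> B") auto
    qed
    also have "\<dots> = e / 2 + 2 * C * prob B"
      by (subst Bochner_Integration.integral_add) (auto simp: prob_space emeasure_eq_measure)
    also have "\<dots> < e" using pB C by (simp add: field_simps)
    finally show ?case by (simp add: dist_real_def)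
  qed
qed

section \<open>Tightness of partial sums when the limit is finite\<close>

lemma squash_antimono: "s \<le> t \<Longrightarrow> squash t \<le> squash s"
  by (cases s; cases t; auto simp: squash_ennreal squash_top divide_simps top_unique)

lemma (in prob_space) conv_in_law_tight:
  fixes R :: "nat \<Rightarrow> 'a \<Rightarrow> (nat \<Rightarrow> ennreal) \<times> 'f::topological_space"
  assumes R: "\<And>l. R l \<in> borel_measurable M" and P: "prob_space P" and Z: "Z \<in> borel_measurable P"
    and Z_fin: "\<And>\<omega> k. \<omega> \<in> space P \<Longrightarrow> fst (Z \<omega>) k \<noteq> \<infinity>"
    and conv: "conv_in_law M R P Z" and e: "0 < e"
  shows "\<exists>L>0. \<forall>\<^sub>F l in sequentially. \<exists>B\<in>sets M. prob B < e \<and>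
    (\<forall>x\<in>space M - B. (\<Sum>i<K. fst (R l x) i) \<le> ennreal L)"
proof -
  interpret P: prob_space P by (rule P)
  define s where "s = (\<lambda>z :: (nat \<Rightarrow> ennreal) \<times> 'f. \<Sum>i<K. fst z i)"
  \<comment> \<open>\<open>w n\<close> is a continuous substitute for the indicator of
    \<open>s z > n + 1\<close>: it takes values in \<open>[0, 1]\<close>, is at least 1/2 on that
    set, and tends to 0 wherever \<open>s z\<close> is finite.\<close>
  define w where "w n z = 1 - squash (ennreal (1 / real (Suc n)) * s z)" for n z
  have s_cont: "continuous_on UNIV s"
  proof -
    have "continuous_on UNIV (\<lambda>z :: (nat \<Rightarrow> ennreal) \<times> 'f. \<Sum>i\<in>I. fst z i)" if "finite I" for I
      using that
    proof induction
      case (insert i I)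
      have "continuous_on UNIV (\<lambda>z :: (nat \<Rightarrow> ennreal) \<times> 'f. fst z i)"
        by (rule continuous_on_product_then_coordinatewise[OF continuous_on_fst[OF continuous_on_id]])
      then show ?case using insert by (auto intro!: continuous_on_add_ennreal)
    qed auto
    then show ?thesis by (simp add: s_def)
  qed
  have w_cont: "continuous_on UNIV (w n)" for n
    unfolding w_def
    by (intro continuous_on_diff continuous_on_const continuous_on_compose2[OF continuous_on_squash]
        ennreal_continuous_on_cmult s_cont) auto
  have w01: "0 \<le> w n z" "w n z \<le> 1" for n z
    by (auto simp: w_def squash_bounds)
  have w_half: "1 / 2 \<le> w n z" if "s z > ennreal (Suc n)" for n z
  proof -
    have "(1::ennreal) = ennreal (1 / real (Suc n)) * ennreal (real (Suc n))"
      by (subst ennreal_mult[symmetric]) auto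
    also have "\<dots> \<le> ennreal (1 / real (Suc n)) * s z" using that by (intro mult_left_mono) auto
    finally have "squash (ennreal (1 / real (Suc n)) * s z) \<le> squash (ennreal 1)"
      by (intro squash_antimono) simp
    then show ?thesis unfolding w_def by (subst (asm) squash_ennreal) auto
  qed
  have "(\<lambda>n. \<integral>\<omega>. w n (Z \<omega>) \<partial>P) \<longlonglongrightarrow> (\<integral>\<omega>. 0 \<partial>P)"
  proof (rule integral_dominated_convergence[where w="\<lambda>_. 1"])
    show "AE \<omega> in P. (\<lambda>n. w n (Z \<omega>)) \<longlonglongrightarrow> 0"
    proof (rule AE_I2)
      fix \<omega> assume "\<omega> \<in> space P"
      then have "s (Z \<omega>) \<noteq> top" using Z_fin by (simp add: s_def)
      then obtain r where r: "s (Z \<omega>) = ennreal r" "0 \<le> r" by (cases "s (Z \<omega>)") auto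
      have "w n (Z \<omega>) = 1 - 1 / (1 + r / real (Suc n))" for n
        using r(2) unfolding w_def r(1) by (subst ennreal_mult[symmetric]) (auto simp: squash_ennreal)
      moreover have "(\<lambda>n. 1 - 1 / (1 + r / real (Suc n))) \<longlonglongrightarrow> 1 - 1 / (1 + 0)"
        by (intro tendsto_intros LIMSEQ_Suc[OF lim_const_over_n]) auto
      ultimately show "(\<lambda>n. w n (Z \<omega>)) \<longlonglongrightarrow> 0" by simp
    qed
    show "(\<lambda>\<omega>. w n (Z \<omega>)) \<in> borel_measurable P" for n
      by (rule measurable_compose[OF Z borel_measurable_continuous_onI[OF w_cont]])
    show "AE \<omega> in P. norm (w n (Z \<omega>)) \<le> 1" for n using w01 by auto
  qed auto
  then have "\<forall>\<^sub>F n in sequentially. (\<integral>\<omega>. w n (Z \<omega>) \<partial>P) < e / 2"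
    using e by (intro order_tendstoD) auto
  then obtain n where n: "(\<integral>\<omega>. w n (Z \<omega>) \<partial>P) < e / 2"
    by (auto simp: eventually_sequentially)
  have "bounded (range (w n))" using w01 by (intro boundedI[of _ 1]) auto
  then have "(\<lambda>l. \<integral>x. w n (R l x) \<partial>M) \<longlonglongrightarrow> (\<integral>\<omega>. w n (Z \<omega>) \<partial>P)"
    using conv w_cont unfolding conv_in_law_iff[OF R Z] by blast
  then have ev: "\<forall>\<^sub>F l in sequentially. (\<integral>x. w n (R l x) \<partial>M) < e / 2"
    using n by (rule order_tendstoD)
  show ?thesis
  proof (intro exI[of _ "real (Suc n)"] conjI)
    show "\<forall>\<^sub>F l in sequentially. \<exists>B\<in>sets M. prob B < e \<and>
        (\<forall>x\<in>space M - B. (\<Sum>i<K. fst (R l x) i) \<le> ennreal (real (Suc n)))"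
      using ev
    proof eventually_elim
      case (elim l)
      define B where "B = {x \<in> space M. s (R l x) > ennreal (Suc n)}"
      have [measurable]: "(\<lambda>x. s (R l x)) \<in> borel_measurable M" "(\<lambda>x. w n (R l x)) \<in> borel_measurable M"
        using measurable_compose[OF R borel_measurable_continuous_onI[OF s_cont]]
          measurable_compose[OF R borel_measurable_continuous_onI[OF w_cont]] by auto
      have B [measurable]: "B \<in> sets M" unfolding B_def by measurable
      \<comment> \<open>Markov's inequality: the indicator of \<open>B\<close> is at most twice
        \<open>w n\<close>, which is why the integral was made smaller than
        \<open>e / 2\<close>.\<close>
      have "(\<integral>x. indicator B x \<partial>M) \<le> (\<integral>x. 2 * w n (R l x) \<partial>M)"
      proof (rule integral_mono)
        show "integrable M (\<lambda>x. 2 * w n (R l x))"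
          by (rule integrable_const_bound[where B=2]) (use w01 in auto)
        fix x
        show "indicator B x \<le> 2 * w n (R l x)"
          using w01(1)[of n "R l x"] w_half[of n "R l x"] by (auto simp: B_def indicator_def)
      qed (auto simp: emeasure_eq_measure)
      then have "prob B < e" using elim by simp
      moreover have "(\<Sum>i<K. fst (R l x) i) \<le> ennreal (real (Suc n))" if "x \<in> space M - B" for x
        using that by (auto simp: B_def s_def not_less)
      ultimately show ?case using B by blast
    qed
  qed simp
qed

lemma tendsto_iff_if_diff_tendsto_0:
  fixes a b :: "nat \<Rightarrow> real"
  assumes "(\<lambda>l. a l - b l) \<longlonglongrightarrow> 0"
  shows "a \<longlonglongrightarrow> c \<longleftrightarrow> b \<longlonglongrightarrow> c"
  using tendsto_diff[OF _ assms, of a c] tendsto_add[OF _ assms, of b c] by auto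

lemma (in prob_space) integral_diff_tendsto_0_if_close:
  fixes R R' :: "nat \<Rightarrow> 'a \<Rightarrow> (nat \<Rightarrow> ennreal) \<times> (nat \<Rightarrow> 'f::metric_space)" and f :: "_ \<Rightarrow> real"
  assumes F: "compact (UNIV :: 'f set)" and f: "continuous_on UNIV f" "bounded (range f)"
    and R: "\<And>l. R l \<in> borel_measurable M" and R': "\<And>l. R' l \<in> borel_measurable M"
    and close: "\<And>d K e. 0 < d \<Longrightarrow> 0 < e \<Longrightarrow> \<forall>\<^sub>F l in sequentially.
      \<exists>B\<in>sets M. prob B < e \<and> (\<forall>x\<in>space M - B. close d K (R l x) (R' l x))"
  shows "(\<lambda>l. (\<integral>x. f (R l x) \<partial>M) - (\<integral>x. f (R' l x) \<partial>M)) \<longlonglongrightarrow> 0"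
proof (rule Lim_null_comparison[OF always_eventually L1_tendsto_0_if_close[OF assms]], intro allI)
  fix l
  obtain C where C: "\<And>z. \<bar>f z\<bar> \<le> C" using f(2) unfolding bounded_pos by auto
  have "integrable M (\<lambda>x. f (R l x))" "integrable M (\<lambda>x. f (R' l x))"
    by (rule integrable_const_bound[where B=C], simp add: C,
      rule measurable_compose[OF _ borel_measurable_continuous_onI[OF f(1)]], rule R R')+
  then show "norm ((\<integral>x. f (R l x) \<partial>M) - (\<integral>x. f (R' l x) \<partial>M)) \<le> (\<integral>x. \<bar>f (R l x) - f (R' l x)\<bar> \<partial>M)"
    using integral_norm_bound[of M "\<lambda>x. f (R l x) - f (R' l x)"] by simp
qed

text \<open>For scaled waiting times this is the scaled time of the \<open>k\<close>-th visit.
  \<open>enn2real\<close> turns \<open>top\<close> into 0, so the comparisons below work with finite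
  entries.\<close>

definition partial_sum :: "(nat \<Rightarrow> ennreal) \<Rightarrow> nat \<Rightarrow> real" where
  "partial_sum z k = (\<Sum>i<k. enn2real (z i))"

lemma partial_sum_mono: "j \<le> k \<Longrightarrow> partial_sum z j \<le> partial_sum z k"
  unfolding partial_sum_def by (rule sum_mono2) auto

text \<open>Sequences whose partial sums have ratio close to 1 need not have close entries where these sums
  are large; tightness of the partial sums, a consequence of the finiteness of the limit, excludes this.\<close>

lemma (in prob_space) conv_in_law_if_partial_sums_close:
  fixes R R' :: "nat \<Rightarrow> 'a \<Rightarrow> (nat \<Rightarrow> ennreal) \<times> (nat \<Rightarrow> 'f::metric_space)"
  assumes F: "compact (UNIV :: 'f set)"
    and R: "\<And>l. R l \<in> borel_measurable M" and R': "\<And>l. R' l \<in> borel_measurable M"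
    and P: "prob_space P" and Z: "Z \<in> borel_measurable P"
    and Z_fin: "\<And>\<omega> k. \<omega> \<in> space P \<Longrightarrow> fst (Z \<omega>) k \<noteq> \<infinity>"
    and near: "\<And>d e. 0 < d \<Longrightarrow> 0 < e \<Longrightarrow> \<forall>\<^sub>F l in sequentially.
      \<exists>B\<in>sets M. prob B < e \<and> (\<forall>x\<in>space M - B. snd (R l x) = snd (R' l x) \<and>
        (\<forall>k. fst (R l x) k \<noteq> \<infinity> \<and> fst (R' l x) k \<noteq> \<infinity> \<and>
          \<bar>partial_sum (fst (R l x)) k - partial_sum (fst (R' l x)) k\<bar> \<le> d * partial_sum (fst (R l x)) k))"
    and conv: "conv_in_law M R P Z"
  shows "conv_in_law M R' P Z"
proof -
  have close: "\<forall>\<^sub>F l in sequentially. \<exists>B\<in>sets M. prob B < e \<and> (\<forall>x\<in>space M - B. close d K (R l x) (R' l x))"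
    if d: "0 < d" and e: "0 < e" for d e K
  proof -
    \<comment> \<open>The entry with index \<open>K\<close> is a difference of two partial sums, the
      longer of which has \<open>Suc K\<close> terms.\<close>
    obtain L where L: "0 < L" and ev1: "\<forall>\<^sub>F l in sequentially. \<exists>B\<in>sets M. prob B < e / 2 \<and>
        (\<forall>x\<in>space M - B. (\<Sum>i<Suc K. fst (R l x) i) \<le> ennreal L)"
      using conv_in_law_tight[OF R P Z Z_fin conv, of "e / 2" "Suc K"] e by auto
    \<comment> \<open>Where the sums are at most \<open>L\<close>, the relative error
      \<open>d / (3 * L)\<close> is an absolute error of at most \<open>d / 3\<close>. An entry
      involves two sums, and \<open>2 * d / 3\<close> is still strictly below
      \<open>d\<close>.\<close>
    have ev2: "\<forall>\<^sub>F l in sequentially. \<exists>B\<in>sets M. prob B < e / 2 \<and> (\<forall>x\<in>space M - B. snd (R l x) = snd (R' l x) \<and>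
        (\<forall>k. fst (R l x) k \<noteq> \<infinity> \<and> fst (R' l x) k \<noteq> \<infinity> \<and>
          \<bar>partial_sum (fst (R l x)) k - partial_sum (fst (R' l x)) k\<bar> \<le> (d / (3 * L)) * partial_sum (fst (R l x)) k))"
      using d e L by (intro near) auto
    show ?thesis using ev1 ev2
    proof eventually_elim
      case (elim l)
      from elim(1) obtain B1 where B1: "B1 \<in> sets M" "prob B1 < e / 2"
        "\<And>x. x \<in> space M \<Longrightarrow> x \<notin> B1 \<Longrightarrow> (\<Sum>i<Suc K. fst (R l x) i) \<le> ennreal L" by blast
      from elim(2) obtain B2 where B2: "B2 \<in> sets M" "prob B2 < e / 2"
        "\<And>x. x \<in> space M \<Longrightarrow> x \<notin> B2 \<Longrightarrow> snd (R l x) = snd (R' l x) \<and>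
        (\<forall>k. fst (R l x) k \<noteq> \<infinity> \<and> fst (R' l x) k \<noteq> \<infinity> \<and>
          \<bar>partial_sum (fst (R l x)) k - partial_sum (fst (R' l x)) k\<bar> \<le> (d / (3 * L)) * partial_sum (fst (R l x)) k)" by blast
      have "prob (B1 \<union> B2) < e" using measure_Un_le[OF B1(1) B2(1)] B1 B2 by linarith
      moreover have "close d K (R l x) (R' l x)" if x: "x \<in> space M - (B1 \<union> B2)" for x
      proof -
        let ?a = "fst (R l x)" and ?b = "fst (R' l x)"
        have fin: "?a k \<noteq> \<infinity>" "?b k \<noteq> \<infinity>" for k using B2(3)[of x] x by auto
        have "ennreal (partial_sum ?a (Suc K)) = (\<Sum>i<Suc K. ?a i)"
          unfolding partial_sum_def using fin
          by (subst sum_ennreal[symmetric]) (auto simp: less_top simp del: sum.lessThan_Suc)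
        also have "\<dots> \<le> ennreal L" using B1(3)[of x] x by auto
        finally have "partial_sum ?a (Suc K) \<le> L" using L by (simp add: ennreal_le_iff)
        then have aL: "partial_sum ?a k \<le> L" if "k \<le> Suc K" for k
          using partial_sum_mono[OF that, of ?a] by linarith
        have diff: "\<bar>partial_sum ?a k - partial_sum ?b k\<bar> \<le> d / 3" if "k \<le> Suc K" for k
        proof -
          have "\<bar>partial_sum ?a k - partial_sum ?b k\<bar> \<le> (d / (3 * L)) * partial_sum ?a k"
            using B2(3)[of x] x by auto
          also have "\<dots> \<le> (d / (3 * L)) * L" using aL[OF that] d L by (intro mult_left_mono) auto
          finally show ?thesis using L by simp
        qed
        have "\<bar>squash (?a k) - squash (?b k)\<bar> < d" if "k \<le> K" for k
        proof -
          have "enn2real (?a k) - enn2real (?b k)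
              = (partial_sum ?a (Suc k) - partial_sum ?b (Suc k)) - (partial_sum ?a k - partial_sum ?b k)"
            by (simp add: partial_sum_def)
          then have "\<bar>enn2real (?a k) - enn2real (?b k)\<bar> \<le> d / 3 + d / 3"
            using diff[of k] diff[of "Suc k"] that by linarith
          then show ?thesis using squash_diff_le[OF fin, of k k] d by linarith
        qed
        then show ?thesis using B2(3)[of x] x by (auto simp: close_def)
      qed
      ultimately show ?case using B1(1) B2(1) by blast
    qed
  qed
  show ?thesis
    unfolding conv_in_law_iff[OF R' Z]
  proof (intro allI impI)
    fix f :: "(nat \<Rightarrow> ennreal) \<times> (nat \<Rightarrow> 'f) \<Rightarrow> real"
    assume f: "continuous_on UNIV f" "bounded (range f)"
    then have "(\<lambda>l. \<integral>x. f (R l x) \<partial>M) \<longlonglongrightarrow> (\<integral>\<omega>. f (Z \<omega>) \<partial>P)"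
      using conv unfolding conv_in_law_iff[OF R Z] by blast
    then show "(\<lambda>l. \<integral>x. f (R' l x) \<partial>M) \<longlonglongrightarrow> (\<integral>\<omega>. f (Z \<omega>) \<partial>P)"
      using tendsto_iff_if_diff_tendsto_0[OF integral_diff_tendsto_0_if_close[OF F f R R' close]] by blast
  qed
qed

section \<open>Hitting times in an ergodic system\<close>

lemma visits_le: "visits T Y n x \<le> n"
proof -
  have "visits T Y n x \<le> (\<Sum>j<n. 1)" unfolding visits_def by (rule sum_mono) (simp add: indicator_def)
  then show ?thesis by simp
qed

lemma real_visits: "real (visits T Y n x) = (\<Sum>j<n. indicator Y ((T ^^ Suc j) x))"
  unfolding visits_def of_nat_sum by (intro sum.cong) (auto simp: indicator_def)

lemma partial_sum_scaled_hits:
  assumes "0 \<le> c" "\<And>i. H i \<noteq> \<infinity>"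
  shows "partial_sum (\<lambda>k. ennreal c * ennreal_of_enat (H k)) k = c * real (\<Sum>i<k. the_enat (H i))"
proof -
  have "enn2real (ennreal c * ennreal_of_enat (H i)) = c * real (the_enat (H i))" for i
  proof -
    obtain n where "H i = enat n" using assms(2)[of i] by auto
    then show ?thesis using assms(1) by (simp add: enn2real_mult)
  qed
  then show ?thesis by (simp add: partial_sum_def sum_distrib_left)
qed

context ergodic_system
begin

lemma visits_measurable [measurable]:
  assumes [measurable]: "Y \<in> sets M"
  shows "(\<lambda>x. real (visits T Y n x)) \<in> borel_measurable M"
  unfolding real_visits by measurable

text \<open>Counting starts at time 1, so Birkhoff's theorem is applied to the indicator of
  \<open>Y\<close> composed with \<open>T\<close>, which has the same mean.\<close>

lemma AE_visits_average:
  assumes [measurable]: "Y \<in> sets M"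
  shows "AE x in M. (\<lambda>n. real (visits T Y n x) / real n) \<longlonglongrightarrow> prob Y"
proof -
  have "(\<integral>x. indicator Y (T x) \<partial>M) = prob Y"
    using integral_T[of "indicator Y"] by simp
  then show ?thesis
    using birkhoff_bounded[of "\<lambda>x. indicator Y (T x)" 1]
    by (simp add: real_visits indicator_def)
qed

lemma visits_average_L1:
  assumes [measurable]: "Y \<in> sets M"
  shows "(\<lambda>n. \<integral>x. \<bar>real (visits T Y n x) / real n - prob Y\<bar> \<partial>M) \<longlonglongrightarrow> 0"
proof -
  have "(\<lambda>n. \<integral>x. \<bar>real (visits T Y n x) / real n - prob Y\<bar> \<partial>M) \<longlonglongrightarrow> (\<integral>x. 0 \<partial>M)"
  proof (rule integral_dominated_convergence[where w="\<lambda>_. 1"])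
    show "AE x in M. (\<lambda>n. \<bar>real (visits T Y n x) / real n - prob Y\<bar>) \<longlonglongrightarrow> 0"
      using AE_visits_average[OF assms] by eventually_elim (simp add: tendsto_rabs_zero LIM_zero)
    show "AE x in M. norm \<bar>real (visits T Y n x) / real n - prob Y\<bar> \<le> 1" for n
    proof (rule AE_I2)
      fix x
      have "0 \<le> real (visits T Y n x) / real n" "real (visits T Y n x) / real n \<le> 1"
        using visits_le[of T Y n x] by (auto simp: divide_le_eq_1)
      then show "norm \<bar>real (visits T Y n x) / real n - prob Y\<bar> \<le> 1"
        using prob_le_1[of Y] measure_nonneg[of M Y] by (simp only: real_norm_def abs_abs abs_le_iff) linarith
    qed
  qed auto
  then show ?thesis by simp
qed

text \<open>An orbit that avoids \<open>A\<close> from some time on has a bounded visit count, so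
  its visit average would tend to 0 instead of \<open>prob A > 0\<close>.\<close>

lemma AE_recurrent:
  assumes [measurable]: "A \<in> sets M" and "0 < prob A"
  shows "AE x in M. \<forall>N. \<exists>n\<ge>N. (T ^^ n) x \<in> A"
  using AE_visits_average[OF assms(1)]
proof eventually_elim
  case (elim x)
  show ?case
  proof (rule ccontr)
    assume "\<not> ?case"
    then obtain N where N: "\<And>n. n \<ge> N \<Longrightarrow> (T ^^ n) x \<notin> A" by blast
    have "visits T A n x = visits T A N x" if "n \<ge> N" for n
    proof -
      have "(T ^^ Suc j) ((T ^^ N) x) \<notin> A" for j
        using N[of "Suc j + N"] by (simp add: funpow_add)
      then have "visits T A (n - N) ((T ^^ N) x) = 0"
        by (simp add: visits_def del: funpow.simps)
      then show ?thesis using visits_add[of T A N "n - N" x] that by simp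
    qed
    then have "\<forall>\<^sub>F n in sequentially. real (visits T A N x) / real n = real (visits T A n x) / real n"
      by (intro eventually_sequentiallyI[of N]) metis
    then have "(\<lambda>n. real (visits T A n x) / real n) \<longlonglongrightarrow> 0"
      by (rule Lim_transform_eventually[OF lim_const_over_n])
    then show False using elim assms(2) LIMSEQ_unique by fastforce
  qed
qed

lemma integral_uniform:
  fixes g :: "'a \<Rightarrow> real"
  assumes [measurable]: "Y \<in> sets M" "g \<in> borel_measurable M" and "0 < prob Y"
  shows "(\<integral>x. g x \<partial>uniform_measure M Y) = (\<integral>x. g x * indicator Y x \<partial>M) / prob Y"
proof -
  have "uniform_measure M Y = density M (\<lambda>x. ennreal (indicator Y x / prob Y))"
    unfolding uniform_measure_def using assms(3)
    by (intro density_cong) (auto simp: emeasure_eq_measure indicator_def divide_ennreal ennreal_1[symmetric] simp del: ennreal_1)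
  then have "(\<integral>x. g x \<partial>uniform_measure M Y) = (\<integral>x. (indicator Y x / prob Y) *\<^sub>R g x \<partial>M)"
    by (simp only:) (rule integral_density, auto)
  also have "\<dots> = (\<integral>x. (g x * indicator Y x) / prob Y \<partial>M)"
    by (intro Bochner_Integration.integral_cong) auto
  finally show ?thesis by simp
qed

text \<open>Asymptotic invariance lets us replace \<open>indicator Y\<close> by its ergodic averages, which
  converge to \<open>prob Y\<close> in mean.\<close>

lemma uniform_measure_integral_diff_tendsto_0:
  fixes g :: "nat \<Rightarrow> 'a \<Rightarrow> real"
  assumes Y [measurable]: "Y \<in> sets M" and pY: "0 < prob Y"
    and g [measurable]: "\<And>l. g l \<in> borel_measurable M" and C: "\<And>l x. \<bar>g l x\<bar> \<le> C"
    and inv: "(\<lambda>l. \<integral>x. \<bar>g l (T x) - g l x\<bar> \<partial>M) \<longlonglongrightarrow> 0"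
  shows "(\<lambda>l. (\<integral>x. g l x \<partial>M) - (\<integral>x. g l x \<partial>uniform_measure M Y)) \<longlonglongrightarrow> 0"
proof -
  \<comment> \<open>\<open>c l 0 / prob Y\<close> is the integral under the conditional measure;
    larger \<open>j\<close> replace \<open>Y\<close> by its preimages.\<close>
  define c where "c l j = (\<integral>x. g l x * indicator Y ((T ^^ j) x) \<partial>M)" for l j
  define r where "r l = (\<integral>x. \<bar>g l (T x) - g l x\<bar> \<partial>M)" for l
  define D where "D n = (\<integral>x. \<bar>real (visits T Y n x) / real n - prob Y\<bar> \<partial>M)" for n
  have C0: "0 \<le> C" using C[of 0 undefined] by linarith
  have r0: "0 \<le> r l" for l by (simp add: r_def)
  have g_int: "integrable M (g l)" for l
    by (rule integrable_const_bound[where B=C]) (auto simp: C)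
  have gY_int: "integrable M (\<lambda>x. g l x * indicator Y ((T ^^ j) x))" for l j
    by (rule integrable_const_bound[where B=C]) (auto simp: C C0 indicator_def)
  have gTY_int: "integrable M (\<lambda>x. g l (T x) * indicator Y ((T ^^ j) x))" for l j
    by (rule integrable_const_bound[where B=C]) (auto simp: C C0 indicator_def)
  have gT_int: "integrable M (\<lambda>x. \<bar>g l (T x) - g l x\<bar>)" for l
  proof (rule integrable_const_bound[where B="2 * C"])
    show "AE x in M. norm \<bar>g l (T x) - g l x\<bar> \<le> 2 * C"
    proof (rule AE_I2)
      fix x show "norm \<bar>g l (T x) - g l x\<bar> \<le> 2 * C" using C[of l x] C[of l "T x"] by simp
    qed
  qed measurable
  \<comment> \<open>Invariance composes the whole integrand with \<open>T\<close>; replacing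
    \<open>g l (T x)\<close> by \<open>g l x\<close> afterwards costs at most
    \<open>r l\<close>.\<close>
  have step: "\<bar>c l j - c l (Suc j)\<bar> \<le> r l" for l j
  proof -
    have "c l j = (\<integral>x. g l (T x) * indicator Y ((T ^^ j) (T x)) \<partial>M)"
      unfolding c_def by (rule integral_T[symmetric]) measurable
    then have "c l j = (\<integral>x. g l (T x) * indicator Y ((T ^^ Suc j) x) \<partial>M)"
      by (simp add: funpow_swap1)
    then have "c l j - c l (Suc j) = (\<integral>x. g l (T x) * indicator Y ((T ^^ Suc j) x) - g l x * indicator Y ((T ^^ Suc j) x) \<partial>M)"
      unfolding c_def using Bochner_Integration.integral_diff[OF gTY_int[of l "Suc j"] gY_int[of l "Suc j"]] by simp
    also have "\<bar>\<dots>\<bar> \<le> (\<integral>x. \<bar>g l (T x) * indicator Y ((T ^^ Suc j) x) - g l x * indicator Y ((T ^^ Suc j) x)\<bar> \<partial>M)"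
      by (rule integral_abs_bound)
    also have "\<dots> \<le> r l"
      unfolding r_def
      by (rule integral_mono[OF _ gT_int]) (use gTY_int gY_int in \<open>auto simp: indicator_def simp del: funpow.simps\<close>)
    finally show ?thesis .
  qed
  have steps: "\<bar>c l 0 - c l j\<bar> \<le> real j * r l" for l j
  proof (induction j)
    case (Suc j)
    then show ?case using step[of l j] by (simp add: algebra_simps)
  qed simp
  \<comment> \<open>The first error comes from replacing \<open>c l 0\<close> by the average of
    \<open>c l 1\<close> to \<open>c l n\<close>, the second from replacing the visit average by
    \<open>prob Y\<close>.\<close>
  have main: "\<bar>c l 0 - prob Y * (\<integral>x. g l x \<partial>M)\<bar> \<le> real n * r l + C * D n" if n: "0 < n" for l n
  proof -
    let ?I = "\<integral>x. g l x * (real (visits T Y n x) / real n) \<partial>M"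
    have "?I = (\<integral>x. (\<Sum>j<n. g l x * indicator Y ((T ^^ Suc j) x)) / real n \<partial>M)"
      unfolding real_visits by (simp add: sum_distrib_left)
    also have "\<dots> = (\<Sum>j<n. c l (Suc j)) / real n"
      unfolding c_def using gY_int
      by (subst integral_divide_zero) (subst Bochner_Integration.integral_sum, auto simp del: funpow.simps)
    finally have "c l 0 - ?I = (\<Sum>j<n. c l 0 - c l (Suc j)) / real n"
      using n by (simp add: sum_subtractf field_simps)
    also have "\<bar>\<dots>\<bar> \<le> (\<Sum>j<n. real n * r l) / real n"
    proof -
      have "\<bar>c l 0 - c l (Suc j)\<bar> \<le> real n * r l" if "j < n" for j
        using steps[of l "Suc j"] mult_right_mono[of "real (Suc j)" "real n" "r l"] that r0[of l] by simp
      then have "\<bar>\<Sum>j<n. c l 0 - c l (Suc j)\<bar> \<le> (\<Sum>j<n. real n * r l)"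
        by (intro order_trans[OF sum_abs sum_mono]) auto
      then show ?thesis using n by (simp add: field_simps)
    qed
    also have "\<dots> = real n * r l" using n by simp
    finally have 1: "\<bar>c l 0 - ?I\<bar> \<le> real n * r l" .
    have v: "\<bar>real (visits T Y n x) / real n\<bar> \<le> 1" for x
      using visits_le[of T Y n x] by (auto simp: divide_le_eq_1)
    have int1: "integrable M (\<lambda>x. g l x * (real (visits T Y n x) / real n))"
    proof (rule integrable_const_bound[where B=C])
      show "AE x in M. norm (g l x * (real (visits T Y n x) / real n)) \<le> C"
        using mult_mono[OF C v C0 abs_ge_zero] by (simp add: abs_mult)
    qed measurable
    have int2: "integrable M (\<lambda>x. \<bar>real (visits T Y n x) / real n - prob Y\<bar>)"
    proof (rule integrable_const_bound[where B=2])
      have "\<bar>real (visits T Y n x) / real n - prob Y\<bar> \<le> 2" for x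
        using v[of x] prob_le_1[of Y] measure_nonneg[of M Y] by linarith
      then show "AE x in M. norm \<bar>real (visits T Y n x) / real n - prob Y\<bar> \<le> 2" by simp
    qed measurable
    have "?I - prob Y * (\<integral>x. g l x \<partial>M) = (\<integral>x. g l x * (real (visits T Y n x) / real n) - prob Y * g l x \<partial>M)"
      using int1 g_int by simp
    also have "\<bar>\<dots>\<bar> \<le> (\<integral>x. \<bar>g l x * (real (visits T Y n x) / real n) - prob Y * g l x\<bar> \<partial>M)"
      by (rule integral_abs_bound)
    also have "\<dots> \<le> (\<integral>x. C * \<bar>real (visits T Y n x) / real n - prob Y\<bar> \<partial>M)"
    proof (rule integral_mono)
      show "integrable M (\<lambda>x. \<bar>g l x * (real (visits T Y n x) / real n) - prob Y * g l x\<bar>)"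
        using int1 g_int by auto
      show "integrable M (\<lambda>x. C * \<bar>real (visits T Y n x) / real n - prob Y\<bar>)"
        using int2 by auto
      fix x
      have "\<bar>g l x * (real (visits T Y n x) / real n) - prob Y * g l x\<bar> = \<bar>g l x\<bar> * \<bar>real (visits T Y n x) / real n - prob Y\<bar>"
        by (simp add: abs_mult[symmetric] algebra_simps)
      also have "\<dots> \<le> C * \<bar>real (visits T Y n x) / real n - prob Y\<bar>"
        by (intro mult_right_mono C) simp
      finally show "\<bar>g l x * (real (visits T Y n x) / real n) - prob Y * g l x\<bar> \<le> C * \<bar>real (visits T Y n x) / real n - prob Y\<bar>" .
    qed
    also have "\<dots> = C * D n" unfolding D_def using int2 by simp
    finally show ?thesis using 1 by linarith
  qed
  have "(\<lambda>l. c l 0 - prob Y * (\<integral>x. g l x \<partial>M)) \<longlonglongrightarrow> 0"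
  proof (rule tendstoI)
    fix e :: real assume e: "0 < e"
    \<comment> \<open>The order of choices matters: first a fixed \<open>n\<close> that makes the
      ergodic error small, then large \<open>l\<close> for this \<open>n\<close>.\<close>
    have "(\<lambda>n. C * D n) \<longlonglongrightarrow> C * 0"
      unfolding D_def by (intro tendsto_mult tendsto_const visits_average_L1 Y)
    then have "\<forall>\<^sub>F n in sequentially. C * D n < e / 2" using e by (intro order_tendstoD) auto
    then have "\<forall>\<^sub>F n in sequentially. C * D n < e / 2 \<and> 0 < n"
      using eventually_gt_at_top[of 0] by (rule eventually_conj)
    then obtain n where n: "C * D n < e / 2" "0 < n" by (auto simp: eventually_sequentially)
    have "(\<lambda>l. real n * r l) \<longlonglongrightarrow> real n * 0"
      unfolding r_def by (intro tendsto_mult tendsto_const inv)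
    then have "\<forall>\<^sub>F l in sequentially. real n * r l < e / 2" using e by (intro order_tendstoD) auto
    then show "\<forall>\<^sub>F l in sequentially. dist (c l 0 - prob Y * (\<integral>x. g l x \<partial>M)) 0 < e"
    proof eventually_elim
      case (elim l)
      then show ?case using main[OF n(2), of l] n(1) by (simp add: dist_real_def)
    qed
  qed
  then have "(\<lambda>l. - (1 / prob Y) * (c l 0 - prob Y * (\<integral>x. g l x \<partial>M))) \<longlonglongrightarrow> - (1 / prob Y) * 0"
    by (intro tendsto_mult tendsto_const)
  moreover have "- (1 / prob Y) * (c l 0 - prob Y * (\<integral>x. g l x \<partial>M)) = (\<integral>x. g l x \<partial>M) - (\<integral>x. g l x \<partial>uniform_measure M Y)" for l
    using pY by (simp add: integral_uniform[OF Y g pY] c_def field_simps)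
  ultimately show ?thesis by simp
qed

text \<open>A union bound over the times 1 to \<open>n\<close>, with each preimage as large as
  \<open>A\<close> by invariance. So a rare set is rarely hit early.\<close>

lemma prob_hit_le:
  assumes A [measurable]: "A \<in> sets M"
  shows "{x \<in> space M. hit T A x \<le> enat n} \<in> sets M"
    and "prob {x \<in> space M. hit T A x \<le> enat n} \<le> real n * prob A"
proof -
  note [measurable] = hit_measurable[OF T_measurable A]
  show "{x \<in> space M. hit T A x \<le> enat n} \<in> sets M" by measurable
  have "prob {x \<in> space M. hit T A x \<le> enat n} \<le> prob (\<Union>j\<in>{1..n}. (T ^^ j) -` A \<inter> space M)"
  proof (rule finite_measure_mono)
    show "{x \<in> space M. hit T A x \<le> enat n} \<subseteq> (\<Union>j\<in>{1..n}. (T ^^ j) -` A \<inter> space M)"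
    proof
      fix x assume x: "x \<in> {x \<in> space M. hit T A x \<le> enat n}"
      then obtain m where "hit T A x = enat m" "m \<le> n" by (cases "hit T A x") auto
      then show "x \<in> (\<Union>j\<in>{1..n}. (T ^^ j) -` A \<inter> space M)" using x by (auto simp: hit_eq_enat_iff)
    qed
  qed measurable
  also have "\<dots> \<le> (\<Sum>j\<in>{1..n}. prob ((T ^^ j) -` A \<inter> space M))"
    by (rule measure_UNION_le) measurable
  also have "\<dots> = real n * prob A" by (simp add: prob_funpow_vimage)
  finally show "prob {x \<in> space M. hit T A x \<le> enat n} \<le> real n * prob A" .
qed

text \<open>An Egorov argument: the sets \<open>B N\<close> decrease to a null set, so almost sure
  convergence is uniform off one of small measure. The minimum makes the error relative to either
  quantity, as needed for both directions of the equivalence.\<close>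

lemma visits_uniform:
  assumes Y [measurable]: "Y \<in> sets M" and pY: "0 < prob Y" and d: "0 < d" and e: "0 < e"
  obtains N B where "B \<in> sets M" "prob B < e"
    "\<And>x n. x \<in> space M - B \<Longrightarrow> N \<le> n \<Longrightarrow>
      \<bar>real (visits T Y n x) - real n * prob Y\<bar> \<le> d * min (real n * prob Y) (real (visits T Y n x))"
proof -
  define G where "G n x \<longleftrightarrow> \<bar>real (visits T Y n x) - real n * prob Y\<bar> \<le> d * min (real n * prob Y) (real (visits T Y n x))" for n x
  define B where "B N = {x \<in> space M. \<exists>n. N \<le> n \<and> \<not> G n x}" for N
  have B [measurable]: "B N \<in> sets M" for N unfolding B_def G_def by measurable
  have "AE x in M. \<exists>N. \<forall>n\<ge>N. G n x"
    using AE_visits_average[OF Y]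
  proof eventually_elim
    case (elim x)
    \<comment> \<open>Tolerance \<open>prob Y / 2\<close> keeps the visit count above half of
      \<open>n * prob Y\<close>, hence also the minimum; tolerance \<open>d * prob Y / 2\<close>
      bounds the error by \<open>d\<close> times that half.\<close>
    have "\<forall>\<^sub>F n in sequentially. dist (real (visits T Y n x) / real n) (prob Y) < min (prob Y / 2) (d * prob Y / 2)"
      using pY d by (intro tendstoD[OF elim]) simp
    then have "\<forall>\<^sub>F n in sequentially. G n x" using eventually_gt_at_top[of 0]
    proof eventually_elim
      case (elim n)
      let ?v = "real (visits T Y n x)"
      have eq: "\<bar>?v - real n * prob Y\<bar> = real n * \<bar>?v / real n - prob Y\<bar>"
        using elim(2) by (simp add: abs_mult[symmetric, of "real n", simplified] field_simps)
      have "real n * \<bar>?v / real n - prob Y\<bar> \<le> real n * (prob Y / 2)"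
        using elim by (intro mult_left_mono) (auto simp: dist_real_def)
      then have h1: "\<bar>?v - real n * prob Y\<bar> \<le> real n * prob Y / 2" using eq by simp
      have "real n * \<bar>?v / real n - prob Y\<bar> \<le> real n * (d * prob Y / 2)"
        using elim by (intro mult_left_mono) (auto simp: dist_real_def)
      then have h2: "\<bar>?v - real n * prob Y\<bar> \<le> d * (real n * prob Y / 2)" using eq by (simp add: algebra_simps)
      have "real n * prob Y / 2 \<le> min (real n * prob Y) ?v"
        using h1 pY by (auto simp: abs_le_iff min_def field_simps)
      then show ?case unfolding G_def using h2 mult_left_mono[of "real n * prob Y / 2" "min (real n * prob Y) ?v" d] d by linarith
    qed
    then show ?case by (simp add: eventually_sequentially)
  qed
  then have "AE x in M. x \<notin> (\<Inter>N. B N)" by eventually_elim (auto simp: B_def)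
  then have "prob (\<Inter>N. B N) = 0" by (subst prob_eq_0) auto
  moreover have "(\<lambda>N. prob (B N)) \<longlonglongrightarrow> prob (\<Inter>N. B N)"
  proof (rule finite_Lim_measure_decseq)
    show "range B \<subseteq> sets M" using B by blast
    show "decseq B" unfolding decseq_def B_def by (blast intro: le_trans)
  qed
  ultimately have "\<forall>\<^sub>F N in sequentially. prob (B N) < e" using e by (intro order_tendstoD) auto
  then obtain N where "prob (B N) < e" by (auto simp: eventually_sequentially)
  show ?thesis
  proof (rule that[OF B \<open>prob (B N) < e\<close>])
    fix x n assume "x \<in> space M - B N" "N \<le> n"
    then have "G n x" unfolding B_def by blast
    then show "\<bar>real (visits T Y n x) - real n * prob Y\<bar> \<le> d * min (real n * prob Y) (real (visits T Y n x))"
      unfolding G_def .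
  qed
qed

text \<open>Three kinds of points are discarded: those where the visit counts are not yet uniform,
  those that hit \<open>A l\<close> by time \<open>N\<close>, and the null set of non-recurrent
  ones. For all others, every visit to \<open>A l\<close> happens after time \<open>N\<close>, where
  the uniform estimate applies.\<close>

lemma partial_sums_near:
  assumes Y [measurable]: "Y \<in> sets M" and pY: "0 < prob Y"
    and A: "\<And>l. A l \<in> sets M" "\<And>l. A l \<subseteq> Y" "\<And>l. 0 < prob (A l)" "(\<lambda>l. prob (A l)) \<longlonglongrightarrow> 0"
    and d: "0 < d" and e: "0 < e"
  shows "\<forall>\<^sub>F l in sequentially. \<exists>B\<in>sets M. prob B < e \<and> (\<forall>x\<in>space M - B. \<forall>k.
     scaled_Phi M T (A l) x k \<noteq> \<infinity> \<and> scaled_Phi_Y M T Y (A l) x k \<noteq> \<infinity> \<and>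
     \<bar>partial_sum (scaled_Phi M T (A l) x) k - partial_sum (scaled_Phi_Y M T Y (A l) x) k\<bar>
       \<le> d * min (partial_sum (scaled_Phi M T (A l) x) k) (partial_sum (scaled_Phi_Y M T Y (A l) x) k))"
proof -
  obtain N B0 where B0 [measurable]: "B0 \<in> sets M" and pB0: "prob B0 < e / 2"
    and N: "\<And>x n. x \<in> space M - B0 \<Longrightarrow> N \<le> n \<Longrightarrow>
      \<bar>real (visits T Y n x) - real n * prob Y\<bar> \<le> d * min (real n * prob Y) (real (visits T Y n x))"
    using visits_uniform[OF Y pY d half_gt_zero[OF e]] by metis
  have "(\<lambda>l. real N * prob (A l)) \<longlonglongrightarrow> real N * 0" by (intro tendsto_mult tendsto_const A)
  then have "\<forall>\<^sub>F l in sequentially. real N * prob (A l) < e / 2" using e by (intro order_tendstoD) auto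
  then show ?thesis
  proof eventually_elim
    case (elim l)
    define B1 where "B1 = {x \<in> space M. hit T (A l) x \<le> enat N}"
    define B2 where "B2 = {x \<in> space M. \<not> (\<forall>N. \<exists>n. n \<ge> N \<and> (T ^^ n) x \<in> A l)}"
    have Al [measurable]: "A l \<in> sets M" by (rule A)
    have B1 [measurable]: "B1 \<in> sets M" and pB1: "prob B1 < e / 2"
      using prob_hit_le[OF Al, of N] elim by (auto simp: B1_def)
    have B2 [measurable]: "B2 \<in> sets M" unfolding B2_def by measurable
    have "AE x in M. x \<notin> B2"
      using AE_recurrent[OF Al A(3)] by eventually_elim (auto simp: B2_def)
    then have pB2: "prob B2 = 0" by (subst prob_eq_0) auto
    define B where "B = B0 \<union> B1 \<union> B2"
    have "B \<in> sets M" by (simp add: B_def)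
    moreover have "prob B < e"
      using measure_Un_le[of "B0 \<union> B1" M B2] measure_Un_le[of B0 M B1] pB0 pB1 pB2 by (simp add: B_def)
    moreover have "scaled_Phi M T (A l) x k \<noteq> \<infinity> \<and> scaled_Phi_Y M T Y (A l) x k \<noteq> \<infinity> \<and>
      \<bar>partial_sum (scaled_Phi M T (A l) x) k - partial_sum (scaled_Phi_Y M T Y (A l) x) k\<bar>
       \<le> d * min (partial_sum (scaled_Phi M T (A l) x) k) (partial_sum (scaled_Phi_Y M T Y (A l) x) k)"
      if x: "x \<in> space M - B" for x k
    proof -
      let ?h = "\<lambda>k. hit T (A l) ((retmap T (A l) ^^ k) x)"
      let ?h' = "\<lambda>k. hit (retmap T Y) (A l) ((retmap T (A l) ^^ k) x)"
      let ?a = "prob (A l)" and ?y = "prob Y"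
      have io: "\<exists>n\<ge>N. (T ^^ n) x \<in> A l" for N using x by (auto simp: B_def B2_def)
      have h: "?h k \<noteq> \<infinity>" for k by (rule recurrent_iterates(2)[OF io])
      have h': "?h' k \<noteq> \<infinity>" for k by (rule recurrent_visits(1)[OF io A(2)])
      define s where "s = (\<Sum>i<k. the_enat (?h i))"
      \<comment> \<open>Since \<open>A l \<subseteq> Y\<close>, conditioning divides by
        \<open>prob Y\<close>, which compensates for the frequency \<open>prob Y\<close> of visits
        to \<open>Y\<close>.\<close>
      have aY: "measure (uniform_measure M Y) (A l) = ?a / ?y"
        using pY A(2)[of l] by (subst measure_uniform_measure) (auto simp: emeasure_eq_measure Int_absorb1)
      have S: "partial_sum (scaled_Phi M T (A l) x) k = ?a * real s"
        unfolding scaled_Phi_def s_def using h by (intro partial_sum_scaled_hits) auto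
      have S': "partial_sum (scaled_Phi_Y M T Y (A l) x) k = ?a / ?y * real (visits T Y s x)"
        unfolding scaled_Phi_Y_def s_def recurrent_visits(2)[OF io A(2), symmetric] aY
        using h' by (intro partial_sum_scaled_hits) auto
      have fin: "scaled_Phi M T (A l) x k \<noteq> \<infinity>" "scaled_Phi_Y M T Y (A l) x k \<noteq> \<infinity>"
        using h[of k] h'[of k] by (auto simp: scaled_Phi_def scaled_Phi_Y_def ennreal_mult_eq_top_iff)
      \<comment> \<open>For \<open>k = 0\<close> both sides are empty sums; otherwise
        \<open>s\<close> is at least the first hitting time and therefore at least
        \<open>N\<close>.\<close>
      have "\<bar>real (visits T Y s x) - real s * ?y\<bar> \<le> d * min (real s * ?y) (real (visits T Y s x))"
      proof (cases k)
        case 0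
        then show ?thesis by (simp add: s_def visits_def)
      next
        case (Suc k')
        have "N \<le> the_enat (?h 0)" using x h[of 0] by (auto simp: B_def B1_def)
        also have "\<dots> \<le> s" unfolding s_def using Suc by (intro member_le_sum) auto
        finally show ?thesis using x N by (auto simp: B_def)
      qed
      then have "?a / ?y * \<bar>real (visits T Y s x) - real s * ?y\<bar> \<le> ?a / ?y * (d * min (real s * ?y) (real (visits T Y s x)))"
        using pY A(3)[of l] by (intro mult_left_mono) auto
      also have "\<dots> = d * min (?a * real s) (?a / ?y * real (visits T Y s x))"
      proof -
        have "?a / ?y * min (real s * ?y) (real (visits T Y s x))
            = min (?a / ?y * (real s * ?y)) (?a / ?y * real (visits T Y s x))"
          using pY A(3)[of l] by (subst min_mult_distrib_left) auto
        then show ?thesis using pY by (simp add: mult.left_commute mult.commute)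
      qed
      also have "?a / ?y * \<bar>real (visits T Y s x) - real s * ?y\<bar> = \<bar>?a * real s - ?a / ?y * real (visits T Y s x)\<bar>"
      proof -
        have "?a * real s - ?a / ?y * real (visits T Y s x) = - (?a / ?y * (real (visits T Y s x) - real s * ?y))"
          using pY by (simp add: field_simps)
        then show ?thesis using pY A(3)[of l] by (simp only: abs_minus_cancel abs_mult) simp
      qed
      finally show ?thesis using fin S S' by simp
    qed
    ultimately show ?case by blast
  qed
qed

lemma close_after_step:
  assumes A: "\<And>l. A l \<in> sets M" "\<And>l. 0 < prob (A l)" "(\<lambda>l. prob (A l)) \<longlonglongrightarrow> 0"
    and d: "0 < d" and e: "0 < e"
  shows "\<forall>\<^sub>F l in sequentially. \<exists>B\<in>sets M. prob B < e \<and> (\<forall>x\<in>space M - B.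
     close d K (scaled_Phi M T (A l) (T x), local_proc T (A l) (psi l) (T x))
       (scaled_Phi M T (A l) x, local_proc T (A l) (psi l) x))"
proof -
  \<comment> \<open>The bound \<open>d\<close> is for the change of the first scaled waiting time,
    which is exactly \<open>prob (A l)\<close>; the bound \<open>e\<close> is for the points that
    enter \<open>A l\<close> in one step.\<close>
  have "\<forall>\<^sub>F l in sequentially. prob (A l) < min d e" using d e by (intro order_tendstoD[OF A(3)]) auto
  then show ?thesis
  proof eventually_elim
    case (elim l)
    define B1 where "B1 = {x \<in> space M. hit T (A l) x \<le> enat 1}"
    define B2 where "B2 = {x \<in> space M. \<not> (\<forall>N. \<exists>n. n \<ge> N \<and> (T ^^ n) x \<in> A l)}"
    have Al [measurable]: "A l \<in> sets M" by (rule A)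
    have B1 [measurable]: "B1 \<in> sets M" and pB1: "prob B1 < e"
      using prob_hit_le[OF Al, of 1] elim by (auto simp: B1_def)
    have B2 [measurable]: "B2 \<in> sets M" unfolding B2_def by measurable
    have "AE x in M. x \<notin> B2"
      using AE_recurrent[OF Al A(2)] by eventually_elim (auto simp: B2_def)
    then have pB2: "prob B2 = 0" by (subst prob_eq_0) auto
    have "prob (B1 \<union> B2) < e"
      using measure_Un_le[of B1 M B2] pB1 pB2 by simp
    moreover have "close d K (scaled_Phi M T (A l) (T x), local_proc T (A l) (psi l) (T x))
       (scaled_Phi M T (A l) x, local_proc T (A l) (psi l) x)" if x: "x \<in> space M - (B1 \<union> B2)" for x
    proof -
      have io: "\<exists>n\<ge>N. (T ^^ n) x \<in> A l" for N using x by (auto simp: B2_def)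
      obtain n where n: "hit T (A l) x = enat n"
        using recurrent_iterates(2)[OF io, where k=0] by auto
      then have n1: "n \<noteq> 1" using x by (auto simp: B1_def)
      have iter: "(retmap T (A l) ^^ Suc k) (T x) = (retmap T (A l) ^^ Suc k) x" for k
        by (rule retmap_iterate_step[OF n n1])
      have "\<bar>squash (scaled_Phi M T (A l) (T x) k) - squash (scaled_Phi M T (A l) x k)\<bar> < d" for k
      proof (cases k)
        case 0
        let ?a = "scaled_Phi M T (A l) (T x) k" and ?b = "scaled_Phi M T (A l) x k"
        have ab: "?a = ennreal (prob (A l)) * ennreal_of_enat (enat (n - 1))"
          "?b = ennreal (prob (A l)) * ennreal_of_enat (enat n)"
          using hit_step(1)[OF n n1] n 0 by (auto simp: scaled_Phi_def)
        have "\<bar>squash ?a - squash ?b\<bar> \<le> \<bar>enn2real ?a - enn2real ?b\<bar>"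
          by (rule squash_diff_le) (auto simp: ab ennreal_mult_eq_top_iff)
        also have "\<dots> = prob (A l)"
          using hit_step(2)[OF n n1] by (simp add: ab enn2real_mult of_nat_diff algebra_simps)
        finally show ?thesis using elim by simp
      next
        case (Suc j)
        then show ?thesis using d by (simp add: scaled_Phi_def iter del: funpow.simps)
      qed
      then show ?thesis by (simp add: close_def local_proc_def iter del: funpow.simps)
    qed
    ultimately show ?case using B1 B2 by blast
  qed
qed

end

section \<open>Equivalence of the two limit statements\<close>

lemma ergodic_system_if_ergodic_pps:
  assumes "ergodic_pps M T"
  shows "ergodic_system M T"
proof -
  have T: "T \<in> measurable M M" "\<And>B. B \<in> sets M \<Longrightarrow> emeasure M (T -` B \<inter> space M) = emeasure M B"
    using assms by (auto simp: ergodic_pps_def mpt_def)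
  have "distr M M T = M"
    by (rule measure_eqI) (auto simp: emeasure_distr T)
  then show ?thesis
    using assms T(1) by (auto simp: ergodic_system_def ergodic_system_axioms_def ergodic_pps_def)
qed

text \<open>The intermediate statement is convergence of the original process \<open>R\<close> under
  the conditional measure. Asymptotic invariance changes the measure with the process fixed; visit
  counts then change the process with the measure fixed.\<close>

lemma (in ergodic_system) conv_in_law_hits_iff_if_measurable:
  fixes psi :: "nat \<Rightarrow> 'a \<Rightarrow> 'f::metric_space" and Z :: "'w \<Rightarrow> (nat \<Rightarrow> ennreal) \<times> (nat \<Rightarrow> 'f)"
  assumes F: "compact (UNIV :: 'f set)"
    and Y [measurable]: "Y \<in> sets M" and pY: "0 < prob Y"
    and A: "\<And>l. A l \<in> sets M" "\<And>l. A l \<subseteq> Y" "\<And>l. 0 < prob (A l)" "(\<lambda>l. prob (A l)) \<longlonglongrightarrow> 0"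
    and meas: "\<And>l. local_proc T (A l) (psi l) \<in> borel_measurable M"
    and P: "prob_space P" and Z: "Z \<in> borel_measurable P"
    and Z_fin: "\<And>\<omega> k. \<omega> \<in> space P \<Longrightarrow> fst (Z \<omega>) k \<noteq> \<infinity>"
  shows "conv_in_law M (\<lambda>l x. (scaled_Phi M T (A l) x, local_proc T (A l) (psi l) x)) P Z
     \<longleftrightarrow> conv_in_law (uniform_measure M Y)
           (\<lambda>l x. (scaled_Phi_Y M T Y (A l) x, local_proc T (A l) (psi l) x)) P Z"
proof -
  define R where "R l x = (scaled_Phi M T (A l) x, local_proc T (A l) (psi l) x)" for l x
  define R' where "R' l x = (scaled_Phi_Y M T Y (A l) x, local_proc T (A l) (psi l) x)" for l x
  let ?\<nu> = "uniform_measure M Y"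
  interpret \<nu>: prob_space ?\<nu>
    using pY by (intro prob_space_uniform_measure) (auto simp: emeasure_eq_measure)
  have R: "R l \<in> borel_measurable M" for l
    unfolding R_def
    by (intro borel_measurable_Pair_second_countable scaled_Phi_measurable meas A T_measurable)
  have R': "R' l \<in> borel_measurable M" for l
    unfolding R'_def
    by (intro borel_measurable_Pair_second_countable scaled_Phi_Y_measurable meas A T_measurable Y)
  have R\<nu>: "R l \<in> borel_measurable ?\<nu>" "R' l \<in> borel_measurable ?\<nu>" for l
    using R[of l] R'[of l] by auto
  have "conv_in_law M R P Z \<longleftrightarrow> conv_in_law ?\<nu> R P Z"
    unfolding conv_in_law_iff[OF R Z] conv_in_law_iff[OF R\<nu>(1) Z]
  proof (intro all_cong1 imp_cong refl)
    fix f :: "(nat \<Rightarrow> ennreal) \<times> (nat \<Rightarrow> 'f) \<Rightarrow> real"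
    assume f: "continuous_on UNIV f" "bounded (range f)"
    obtain C where C: "\<And>z. \<bar>f z\<bar> \<le> C" using f(2) unfolding bounded_pos by auto
    have "(\<lambda>l. \<integral>x. \<bar>f (R l (T x)) - f (R l x)\<bar> \<partial>M) \<longlonglongrightarrow> 0"
    proof (rule L1_tendsto_0_if_close[OF F f _ R])
      show "(\<lambda>x. R l (T x)) \<in> borel_measurable M" for l
        by (rule measurable_compose[OF T_measurable R])
    qed (use close_after_step[OF A(1,3,4)] in \<open>simp add: R_def\<close>)
    then have "(\<lambda>l. (\<integral>x. f (R l x) \<partial>M) - (\<integral>x. f (R l x) \<partial>?\<nu>)) \<longlonglongrightarrow> 0"
      by (intro uniform_measure_integral_diff_tendsto_0[OF Y pY]
          measurable_compose[OF R borel_measurable_continuous_onI[OF f(1)]])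
        (rule C)
    then show "((\<lambda>l. \<integral>x. f (R l x) \<partial>M) \<longlonglongrightarrow> (\<integral>\<omega>. f (Z \<omega>) \<partial>P)) \<longleftrightarrow>
        ((\<lambda>l. \<integral>x. f (R l x) \<partial>?\<nu>) \<longlonglongrightarrow> (\<integral>\<omega>. f (Z \<omega>) \<partial>P))"
      by (rule tendsto_iff_if_diff_tendsto_0)
  qed
  also have "\<dots> \<longleftrightarrow> conv_in_law ?\<nu> R' P Z"
  proof -
    have near: "\<forall>\<^sub>F l in sequentially. \<exists>B\<in>sets ?\<nu>. \<nu>.prob B < e \<and> (\<forall>x\<in>space ?\<nu> - B. snd (R l x) = snd (R' l x) \<and>
        (\<forall>k. fst (R l x) k \<noteq> \<infinity> \<and> fst (R' l x) k \<noteq> \<infinity> \<and>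
          \<bar>partial_sum (fst (R l x)) k - partial_sum (fst (R' l x)) k\<bar>
            \<le> d * min (partial_sum (fst (R l x)) k) (partial_sum (fst (R' l x)) k)))"
      if d: "0 < d" and e: "0 < e" for d e
    proof -
      \<comment> \<open>Conditioning on \<open>Y\<close> enlarges probabilities by at most the
        factor \<open>1 / prob Y\<close>, so the exceptional set is taken smaller by
        \<open>prob Y\<close>.\<close>
      have "0 < e * prob Y" using e pY by simp
      from partial_sums_near[OF Y pY A d this] show ?thesis
      proof eventually_elim
        case (elim l)
        then obtain B where B: "B \<in> sets M" "prob B < e * prob Y"
          "\<And>x k. x \<in> space M - B \<Longrightarrow> scaled_Phi M T (A l) x k \<noteq> \<infinity> \<and> scaled_Phi_Y M T Y (A l) x k \<noteq> \<infinity> \<and>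
            \<bar>partial_sum (scaled_Phi M T (A l) x) k - partial_sum (scaled_Phi_Y M T Y (A l) x) k\<bar>
            \<le> d * min (partial_sum (scaled_Phi M T (A l) x) k) (partial_sum (scaled_Phi_Y M T Y (A l) x) k)"
          by blast
        have "\<nu>.prob B = prob (Y \<inter> B) / prob Y"
          using pY B by (subst measure_uniform_measure) (auto simp: emeasure_eq_measure)
        also have "\<dots> \<le> prob B / prob Y"
          using pY B by (intro divide_right_mono finite_measure_mono) auto
        also have "\<dots> < e" using B pY by (simp add: divide_less_eq)
        finally show ?case using B by (intro bexI[of _ B]) (auto simp: R_def R'_def)
      qed
    qed
    \<comment> \<open>Tightness is available only for the process assumed to converge, so each
      direction needs the error relative to that process; \<open>near1\<close> and
      \<open>near2\<close> weaken the minimum accordingly.\<close>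
    have near1: "\<forall>\<^sub>F l in sequentially. \<exists>B\<in>sets ?\<nu>. \<nu>.prob B < e \<and> (\<forall>x\<in>space ?\<nu> - B. snd (R l x) = snd (R' l x) \<and>
        (\<forall>k. fst (R l x) k \<noteq> \<infinity> \<and> fst (R' l x) k \<noteq> \<infinity> \<and>
          \<bar>partial_sum (fst (R l x)) k - partial_sum (fst (R' l x)) k\<bar> \<le> d * partial_sum (fst (R l x)) k))"
      if d: "0 < d" and e: "0 < e" for d e
      using near[OF that]
    proof eventually_elim
      case (elim l)
      have "d * min a b \<le> d * a" for a b :: real using d by (intro mult_left_mono) auto
      from order_trans[OF _ this] elim show ?case by blast
    qed
    have near2: "\<forall>\<^sub>F l in sequentially. \<exists>B\<in>sets ?\<nu>. \<nu>.prob B < e \<and> (\<forall>x\<in>space ?\<nu> - B. snd (R' l x) = snd (R l x) \<and>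
        (\<forall>k. fst (R' l x) k \<noteq> \<infinity> \<and> fst (R l x) k \<noteq> \<infinity> \<and>
          \<bar>partial_sum (fst (R' l x)) k - partial_sum (fst (R l x)) k\<bar> \<le> d * partial_sum (fst (R' l x)) k))"
      if d: "0 < d" and e: "0 < e" for d e
      using near[OF that]
    proof eventually_elim
      case (elim l)
      have "d * min a b \<le> d * b" for a b :: real using d by (intro mult_left_mono) auto
      from order_trans[OF _ this] elim show ?case
        unfolding abs_minus_commute[of "partial_sum (fst (R' l _)) _"] eq_commute[of "snd (R' l _)"] by blast
    qed
    show ?thesis
      using \<nu>.conv_in_law_if_partial_sums_close[OF F R\<nu> P Z Z_fin near1]
        \<nu>.conv_in_law_if_partial_sums_close[OF F R\<nu>(2,1) P Z Z_fin near2] by blast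
  qed
  finally show ?thesis unfolding R_def R'_def .
qed

text \<open>The observable is only assumed measurable on \<open>A l\<close>, while \<open>local_proc\<close> also evaluates it on the null set
  of points that never enter \<open>A l\<close>; so measurability of the local process is not automatic.  Convergence
  of either sequence of laws forces it for all large \<open>l\<close>, since the law of a non-measurable map has mass 0.\<close>

theorem mainTheorem17:
  fixes M :: "'a measure" and T :: "'a \<Rightarrow> 'a" and Y :: "'a set"
    and A :: "nat \<Rightarrow> 'a set" and psi :: "nat \<Rightarrow> 'a \<Rightarrow> 'f::metric_space"
    and P :: "'w measure" and Z :: "'w \<Rightarrow> (nat \<Rightarrow> ennreal) \<times> (nat \<Rightarrow> 'f)"
  assumes compactF: "compact (UNIV :: 'f set)"
    and erg: "ergodic_pps M T"
    and Y: "Y \<in> sets M" "measure M Y > 0"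
    and A_sets: "\<And>l. A l \<in> sets M" "\<And>l. A l \<subseteq> Y"
    and A_rare: "\<And>l. measure M (A l) > 0" "(\<lambda>l. measure M (A l)) \<longlonglongrightarrow> 0"
    and psi_meas: "\<And>l. psi l \<in> borel_measurable (restrict_space M (A l))"
    and P: "prob_space P"
    and Z_meas: "Z \<in> borel_measurable P"
    and Z_fin: "\<And>\<omega> k. \<omega> \<in> space P \<Longrightarrow> fst (Z \<omega>) k \<noteq> \<infinity>"
  shows "conv_in_law M (\<lambda>l x. (scaled_Phi M T (A l) x, local_proc T (A l) (psi l) x)) P Z
     \<longleftrightarrow> conv_in_law (uniform_measure M Y)
           (\<lambda>l x. (scaled_Phi_Y M T Y (A l) x, local_proc T (A l) (psi l) x)) P Z"
proof -
  interpret ergodic_system M T by (rule ergodic_system_if_ergodic_pps[OF erg])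
  let ?R = "\<lambda>l x. (scaled_Phi M T (A l) x, local_proc T (A l) (psi l) x)"
  let ?R' = "\<lambda>l x. (scaled_Phi_Y M T Y (A l) x, local_proc T (A l) (psi l) x)"
  let ?\<nu> = "uniform_measure M Y"
  show ?thesis
  proof (cases "\<forall>\<^sub>F l in sequentially. local_proc T (A l) (psi l) \<in> borel_measurable M")
    case True
    then obtain n where "\<And>l. n \<le> l \<Longrightarrow> local_proc T (A l) (psi l) \<in> borel_measurable M"
      by (auto simp: eventually_sequentially)
    then have n: "local_proc T (A (l + n)) (psi (l + n)) \<in> borel_measurable M" for l by simp
    \<comment> \<open>Dropping the first \<open>n\<close> terms makes all local processes measurable
      without affecting either limit.\<close>
    have "conv_in_law M (\<lambda>l. ?R (l + n)) P Z \<longleftrightarrow> conv_in_law ?\<nu> (\<lambda>l. ?R' (l + n)) P Z"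
      using conv_in_law_hits_iff_if_measurable[of Y "\<lambda>l. A (l + n)" "\<lambda>l. psi (l + n)", OF compactF Y
          A_sets A_rare(1) LIMSEQ_ignore_initial_segment[OF A_rare(2)] n P Z_meas Z_fin] .
    then show ?thesis
      using conv_in_law_shift[of M ?R n P Z] conv_in_law_shift[of ?\<nu> ?R' n P Z] by simp
  next
    case False
    \<comment> \<open>Composition with the continuous second projection; as conditioning on
      \<open>Y\<close> keeps the measurable sets, this serves under both measures and makes both
      sides of the equivalence false.\<close>
    have snd_meas: "local_proc T (A l) (psi l) \<in> borel_measurable M"
      if "(\<lambda>x. (S x, local_proc T (A l) (psi l) x)) \<in> borel_measurable M" for l and S :: "'a \<Rightarrow> nat \<Rightarrow> ennreal"
      using measurable_compose[OF that borel_measurable_continuous_onI[OF continuous_on_snd[OF continuous_on_id]]]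
      by simp
    have "\<not> conv_in_law M ?R P Z"
    proof
      assume "conv_in_law M ?R P Z"
      then have "\<forall>\<^sub>F l in sequentially. ?R l \<in> borel_measurable M"
        by (rule conv_in_law_eventually_measurable[OF _ P Z_meas])
      then have "\<forall>\<^sub>F l in sequentially. local_proc T (A l) (psi l) \<in> borel_measurable M"
        by (rule eventually_mono) (use snd_meas in auto)
      then show False using False by simp
    qed
    moreover have "\<not> conv_in_law ?\<nu> ?R' P Z"
    proof
      assume "conv_in_law ?\<nu> ?R' P Z"
      then have "\<forall>\<^sub>F l in sequentially. ?R' l \<in> borel_measurable ?\<nu>"
        by (rule conv_in_law_eventually_measurable[OF _ P Z_meas])
      then have "\<forall>\<^sub>F l in sequentially. local_proc T (A l) (psi l) \<in> borel_measurable M"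
        by (rule eventually_mono) (use snd_meas in auto)
      then show False using False by simp
    qed
    ultimately show ?thesis by blast
  qed
qed

end
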